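(* Let $k$ and $n$ be integers with $1\le k\le 4$ and $n\ge k+2$. Then $$\log_2\lvert N^{k}_n : N^{k-1}_n\rvert = a_{k+2},$$ where $a_j=\sum_{i=1}^{j} b_i$ and $b_i$ is the number of partitions of $i$ into at least two distinct parts. In particular, for these $k$ and $n$, the number $\log_2\lvert N^{k}_n : N^{k-1}_n\rvert$ is independent of $n$.
   Context: Write $x^y=y^{-1}xy$. For $n\ge 0$ let $X_n=\{1,\dots,2^n\}$ and let $\mathrm{Sym}(2^n)$ be the symmetric group on $X_n$; for $m\le n$, $\mathrm{Sym}(2^m)$ is regarded as the subgroup of $\mathrm{Sym}(2^n)$ fixing every point greater than $2^m$. For $i\ge 1$ put $s_i=\prod_{j=1}^{2^{i-1}}(j,\,j+2^{i-1})$. Let $\Sigma_n=\langle s_1,\dots,s_n\rangle$, a Sylow $2$-subgroup of $\mathrm{Sym}(2^n)$. Define recursively $t^n_n=s_n$ and $t^n_i=t^{n-1}_i\cdot (t^{n-1}_i)^{s_n}$ for $1\le i<n$. Let $T_n=\langle t^n_1,\dots,t^n_n\rangle$, a regular elementary abelian subgroup of $\mathrm{Sym}(2^n)$ of order $2^n$ contained in $\Sigma_n$, and let $U_n=N_{\Sigma_n}(T_n)$. The normalizer chain is defined by $N^0_n=U_n$ and $N^k_n=N_{\mathrm{Sym}(2^n)}(N^{k-1}_n)$ for $k\ge 1$. A partition of $i$ into at least two distinct parts is a way of writing $i$ as a sum of at least two pairwise distinct positive integers, disregarding order. The first values for $j=1,\dots,6$ are $b_j=0,0,1,1,2,3$ and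 $a_j=0,0,1,2,4,7$. *)

theory Defs
  imports Complex_Main "HOL-Algebra.Sym_Groups" "HOL-Algebra.Group_Action"
begin

text \<open>
  Sym($2^n$) is \<^term>\<open>sym_group (2 ^ n)\<close>. Its elements are functions on all of \<^typ>\<open>nat\<close> that are
  the identity outside \<^term>\<open>{1..2 ^ n}\<close>, so the embedding of Sym($2^m$) into Sym($2^n$) for
  $m \le n$ is plain inclusion. The library multiplies permutations by composition
  (right factor applied first). None of the objects below depends on this choice:
  the factors multiplied in \<open>s_gen\<close> and \<open>t_gen\<close> commute, conjugation is only ever by an
  involution, and generated subgroups, normalizers and
  indices of subgroups are the same in a group and in its opposite group.
\<close>

definition s_gen :: "nat \<Rightarrow> nat \<Rightarrow> nat" where
  "s_gen i = foldr (\<circ>) (map (\<lambda>j. Transposition.transpose j (j + 2 ^ (i - 1))) [1..<Suc (2 ^ (i - 1))]) id"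

definition perm_conj :: "(nat \<Rightarrow> nat) \<Rightarrow> (nat \<Rightarrow> nat) \<Rightarrow> nat \<Rightarrow> nat" where
  "perm_conj x y = inv' y \<circ> x \<circ> y"

text \<open>
  \<open>t_gen n i\<close> is $t^n_i$; only the values for $1 \le i \le n$ are meaningful.
\<close>

fun t_gen :: "nat \<Rightarrow> nat \<Rightarrow> nat \<Rightarrow> nat" where
  "t_gen 0 i = id"
| "t_gen (Suc n) i = (if i = Suc n then s_gen (Suc n) else t_gen n i \<circ> perm_conj (t_gen n i) (s_gen (Suc n)))"

definition Sigma_grp :: "nat \<Rightarrow> (nat \<Rightarrow> nat) set" where
  "Sigma_grp n = generate (sym_group (2 ^ n)) (s_gen ` {1..n})"

definition T_grp :: "nat \<Rightarrow> (nat \<Rightarrow> nat) set" where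
  "T_grp n = generate (sym_group (2 ^ n)) (t_gen n ` {1..n})"

definition U_grp :: "nat \<Rightarrow> (nat \<Rightarrow> nat) set" where
  "U_grp n = normalizer ((sym_group (2 ^ n))\<lparr>carrier := Sigma_grp n\<rparr>) (T_grp n)"

fun norm_chain :: "nat \<Rightarrow> nat \<Rightarrow> (nat \<Rightarrow> nat) set" where
  "norm_chain n 0 = U_grp n"
| "norm_chain n (Suc k) = normalizer (sym_group (2 ^ n)) (norm_chain n k)"

text \<open>
  The index $|K : H|$ of subgroups $H \le K$ of \<open>G\<close>.
\<close>

definition subgroup_index :: "('a, 'b) monoid_scheme \<Rightarrow> 'a set \<Rightarrow> 'a set \<Rightarrow> nat" where
  "subgroup_index G K H = card (rcosets\<^bsub>G\<lparr>carrier := K\<rparr>\<^esub> H)"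

text \<open>
  A partition of \<open>i\<close> into distinct parts is encoded as the set of its parts.
\<close>

definition b_seq :: "nat \<Rightarrow> nat" where
  "b_seq i = card {P :: nat set. finite P \<and> 0 \<notin> P \<and> 2 \<le> card P \<and> \<Sum> P = i}"

definition a_seq :: "nat \<Rightarrow> nat" where
  "a_seq j = (\<Sum>i = 1..j. b_seq i)"

end

theory Submission
  imports Defs "HOL-Library.Z2" "HOL-Library.Nat_Bijection"
begin

text \<open>
  The proof describes every member of the normalizer chain explicitly. Identify a point \<open>p\<close> of
  \<open>{1..2 ^ n}\<close> with the vector \<open>x = (x_1, \<dots>, x_n)\<close> of the binary digits of \<open>p - 1\<close> over the
  field with two elements, \<open>x_1\<close> being the most significant one, and a vector with the set of
  its nonzero coordinates. Then \<open>T_grp n\<close> is the group of translations, \<open>Sigma_grp n\<close> is the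
  group of all triangular maps \<open>x_i \<mapsto> x_i + f_i (x_1, \<dots>, x_{i-1})\<close>, and \<open>U_grp n\<close> consists of
  those with all \<open>f_i\<close> of degree at most 1. Every function of \<open>x\<close> is a unique sum of square-free
  monomials, indexed by subsets \<open>S \<subseteq> {1..n}\<close>. Give a monomial \<open>S\<close> occurring in \<open>f_i\<close> the weight
  \<open>\<Sum>S + (n - i)\<close>. For \<open>k + 2 \<le> n\<close>, the group \<open>norm_chain n k\<close> consists of the triangular maps
  whose monomials of degree at least 2 all have weight at most \<open>k + 2\<close> (\<open>norm_chain_eq\<close>).

  The index can be read off from this. The monomials that are admitted in step \<open>k\<close> have weight
  exactly \<open>k + 2\<close>; those in \<open>f_i\<close> are the partitions of \<open>k + 2 - (n - i)\<close> into at least two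
  distinct parts, and summing over \<open>i\<close> gives \<open>a_seq (k + 2)\<close> of them, each with a free
  coefficient in the field (\<open>card_perms_chain\<close>, \<open>card_new_monomials\<close>). The condition \<open>k + 2 \<le> n\<close>
  ensures that all these partitions fit into the variables that are available to \<open>f_i\<close>.

  The description is proved by induction on \<open>k\<close>. Write \<open>c = k + 2\<close>. The group with bound
  \<open>c + 1 \<le> n\<close> normalizes the group with bound \<open>c\<close> because a commutator replaces a factor \<open>x_j\<close>
  of a monomial by a monomial of smaller index sum, which lowers the weight
  (\<open>shift_compose_diff\<close>).

  Conversely, let \<open>g\<close> be a permutation of the points that normalizes the group with bound \<open>c\<close>.
  The centre of that group is generated by the flip of the last coordinate, so \<open>g\<close> commutes with
  this flip and induces a permutation of the vectors of length \<open>n - 1\<close>, which normalizes the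
  group with bound \<open>c - 1\<close> in \<open>n - 1\<close> coordinates (\<open>normalizer_descends\<close>). Induction on \<open>n\<close>
  shows that \<open>g\<close> is triangular and bounds all \<open>f_i\<close> with \<open>i < n\<close>, except that for \<open>c = 2\<close> a
  direct argument takes the place of the induction hypothesis, as both bounds 1 and 2 define the
  affine group (\<open>normalizer_shift_degree_le_1\<close>). The differences of \<open>f_n\<close> along affine
  triangular maps have only monomials admissible for \<open>c\<close>; since a suitable translation or a map
  \<open>x_j \<mapsto> x_j + x_{j-1}\<close> lowers the weight of a heaviest monomial by only one, \<open>f_n\<close> respects the
  bound \<open>c + 1\<close> (\<open>monomial_bound_from_differences\<close>, \<open>normalizer_in_chain\<close>).
\<close>

section \<open>Functions on subsets as polynomials over the field with two elements\<close>

text \<open>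
  Addition and multiplication are kept as field operations instead of being unfolded into bit
  operations.
\<close>

declare add_bit_eq_xor [simp del] mult_bit_eq_and [simp del]

lemma bit_add_self [simp]: "(x :: bit) + x = 0"
  by (cases x) auto

lemma bit_add_self_left [simp]: "(x :: bit) + (x + y) = y"
  by (simp flip: add.assoc)

lemma bit_eq_iff_1: "(x :: bit) = y \<longleftrightarrow> (x = 1 \<longleftrightarrow> y = 1)"
  by (cases x; cases y) auto

text \<open>
  A function with values in the field with two elements is a unique sum of monomials, the
  monomial of \<open>S\<close> being the product of the coordinates in \<open>S\<close>, which is 1 at \<open>A\<close> iff \<open>S \<subseteq> A\<close>. In
  characteristic 2 the passage from coefficients to values (sum over all subsets) is its own
  inverse (\<open>zeta_zeta\<close> below), so \<open>zeta f S\<close> is also the coefficient of the monomial of \<open>S\<close> in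
  \<open>f\<close>.
\<close>

definition zeta :: "('a set \<Rightarrow> bit) \<Rightarrow> 'a set \<Rightarrow> bit" where
  "zeta f A = (\<Sum>S\<in>Pow A. f S)"

lemma zeta_cong: "(\<And>S. S \<subseteq> A \<Longrightarrow> f S = g S) \<Longrightarrow> zeta f A = zeta g A"
  unfolding zeta_def by (rule sum.cong) auto

lemma zeta_add: "zeta (\<lambda>A. f A + g A) A = zeta f A + zeta g A"
  by (simp add: zeta_def sum.distrib)

lemma zeta_empty [simp]: "zeta f {} = f {}"
  by (simp add: zeta_def)

lemma zeta_insert:
  assumes "finite A" "a \<notin> A"
  shows "zeta f (insert a A) = zeta f A + zeta (\<lambda>S. f (insert a S)) A"
proof -
  have inj: "inj_on (insert a) (Pow A)"
    using assms by (auto simp: inj_on_def)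
  have "zeta f (insert a A) = sum f (Pow A) + sum f (insert a ` Pow A)"
    unfolding zeta_def Pow_insert using assms by (intro sum.union_disjoint) auto
  then show ?thesis
    by (simp add: zeta_def sum.reindex[OF inj])
qed

text \<open>
  Splitting off an element \<open>a\<close> doubles the terms not involving \<open>a\<close>; these cancel in pairs.
\<close>

lemma zeta_zeta:
  assumes "finite A"
  shows "zeta (zeta f) A = f A"
  using assms
proof (induction A arbitrary: f rule: finite_induct)
  case (insert a A)
  have "zeta (\<lambda>S. zeta f (insert a S)) A
      = zeta (\<lambda>S. zeta f S + zeta (\<lambda>S. f (insert a S)) S) A"
    by (rule zeta_cong, rule zeta_insert) (use insert.hyps in \<open>auto intro: finite_subset\<close>)
  then show ?case
    using insert by (simp add: zeta_insert zeta_add)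
qed simp

lemma zeta_delta:
  assumes "finite A"
  shows "zeta (\<lambda>T. of_bool (T = S)) A = of_bool (S \<subseteq> A)"
proof -
  have "zeta (\<lambda>T. of_bool (T = S)) A = (\<Sum>T\<in>Pow A. if T = S then 1 else 0)"
    unfolding zeta_def by (rule sum.cong) auto
  then show ?thesis
    using assms by simp
qed

text \<open>
  The functions of \<open>n\<close> coordinates all of whose monomials lie in \<open>F\<close>. Membership depends only on
  the values at subsets of \<open>{1..n}\<close>.
\<close>

definition polys :: "nat \<Rightarrow> nat set set \<Rightarrow> (nat set \<Rightarrow> bit) set" where
  "polys n F = {f. \<forall>S\<subseteq>{1..n}. zeta f S \<noteq> 0 \<longrightarrow> S \<in> F}"

lemma polysD: "f \<in> polys n F \<Longrightarrow> S \<subseteq> {1..n} \<Longrightarrow> zeta f S \<noteq> 0 \<Longrightarrow> S \<in> F"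
  by (auto simp: polys_def)

lemma finite_cube: "A \<subseteq> {1..n::nat} \<Longrightarrow> finite A"
  by (rule finite_subset) auto

lemma polysI:
  assumes "\<And>A. A \<subseteq> {1..n} \<Longrightarrow> f A = zeta c A"
    and "\<And>S. S \<subseteq> {1..n} \<Longrightarrow> c S \<noteq> 0 \<Longrightarrow> S \<in> F"
  shows "f \<in> polys n F"
  unfolding polys_def
proof (intro CollectI allI impI)
  fix S assume S: "S \<subseteq> {1..n}" "zeta f S \<noteq> 0"
  have "zeta f S = zeta (zeta c) S"
    using assms(1) S(1) by (intro zeta_cong) auto
  then show "S \<in> F"
    using S assms(2) by (simp add: zeta_zeta finite_cube)
qed

lemma polys_cong:
  assumes "\<And>A. A \<subseteq> {1..n} \<Longrightarrow> f A = g A"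
  shows "f \<in> polys n F \<longleftrightarrow> g \<in> polys n F"
proof -
  have "zeta f S = zeta g S" if "S \<subseteq> {1..n}" for S
    using that assms by (intro zeta_cong) auto
  then show ?thesis
    by (auto simp: polys_def)
qed

lemma polys_mono: "f \<in> polys n F \<Longrightarrow> (\<And>S. S \<subseteq> {1..n} \<Longrightarrow> S \<in> F \<Longrightarrow> S \<in> G) \<Longrightarrow> f \<in> polys n G"
  by (auto simp: polys_def)

lemma polys_Int: "f \<in> polys n F \<Longrightarrow> f \<in> polys n G \<Longrightarrow> f \<in> polys n (F \<inter> G)"
  by (auto simp: polys_def)

lemma polys_zero: "(\<lambda>A. 0) \<in> polys n F"
  by (simp add: polys_def zeta_def)

lemma polys_add: "f \<in> polys n F \<Longrightarrow> g \<in> polys n F \<Longrightarrow> (\<lambda>A. f A + g A) \<in> polys n F"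
  unfolding polys_def by (auto simp: zeta_add)

lemma polys_sum:
  assumes "\<And>i. i \<in> I \<Longrightarrow> f i \<in> polys n F"
  shows "(\<lambda>A. \<Sum>i\<in>I. f i A) \<in> polys n F"
  using assms
proof (induction I rule: infinite_finite_induct)
  case (insert i I)
  then have "(\<lambda>A. f i A + (\<Sum>i\<in>I. f i A)) \<in> polys n F"
    by (intro polys_add) auto
  then show ?case
    using insert by simp
qed (simp_all add: polys_zero)

lemma polys_monomial:
  assumes "S \<in> F"
  shows "(\<lambda>A. of_bool (S \<subseteq> A)) \<in> polys n F"
  by (rule polysI[where c = "\<lambda>T. of_bool (T = S)"])
     (use assms in \<open>auto simp: zeta_delta finite_cube split: if_splits\<close>)

lemma polys_const: "{} \<in> F \<Longrightarrow> (\<lambda>A. a) \<in> polys n F"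
  using polys_monomial[of "{}" F n] polys_zero[of n F] by (cases a) auto

lemma monomial_expansion:
  fixes A :: "nat set"
  assumes "A \<subseteq> {1..n}"
  shows "f A = (\<Sum>S\<in>Pow {1..n}. zeta f S * of_bool (S \<subseteq> A))"
proof -
  have "f A = (\<Sum>S\<in>Pow A. zeta f S)"
    using zeta_zeta[OF finite_cube[OF assms], of f] by (simp add: zeta_def[of "zeta f"])
  also have "\<dots> = (\<Sum>S\<in>Pow A. zeta f S * of_bool (S \<subseteq> A))"
    by (rule sum.cong) auto
  also have "\<dots> = (\<Sum>S\<in>Pow {1..n}. zeta f S * of_bool (S \<subseteq> A))"
    by (rule sum.mono_neutral_left) (use assms in auto)
  finally show ?thesis .
qed

lemma polys_mult:
  assumes f: "f \<in> polys n F" and g: "g \<in> polys n G"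
    and FG: "\<And>S T. S \<in> F \<Longrightarrow> T \<in> G \<Longrightarrow> S \<union> T \<in> H"
  shows "(\<lambda>A. f A * g A) \<in> polys n H"
proof -
  let ?h = "\<lambda>A. \<Sum>S\<in>Pow {1..n}. \<Sum>T\<in>Pow {1..n}. zeta f S * zeta g T * of_bool (S \<union> T \<subseteq> A)"
  have "(\<lambda>A. zeta f S * zeta g T * of_bool (S \<union> T \<subseteq> A)) \<in> polys n H"
    if "S \<in> Pow {1..n}" "T \<in> Pow {1..n}" for S T
  proof (cases "zeta f S = 0 \<or> zeta g T = 0")
    case True
    then show ?thesis
      by (auto simp: polys_zero)
  next
    case False
    then have "S \<union> T \<in> H"
      using polysD[OF f] polysD[OF g] that FG by auto
    from polys_monomial[OF this] False show ?thesis
      by simp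
  qed
  then have "?h \<in> polys n H"
    by (intro polys_sum)
  moreover have "f A * g A = ?h A" if "A \<subseteq> {1..n}" for A
    unfolding monomial_expansion[OF that, of f] monomial_expansion[OF that, of g] sum_product
    by (intro sum.cong refl) auto
  ultimately show ?thesis
    by (rule polys_cong[THEN iffD2, rotated])
qed

text \<open>
  The general substitution principle: it suffices to know what a map does to the monomials in
  \<open>F\<close>.
\<close>

lemma polys_compose:
  assumes f: "f \<in> polys n F"
    and g: "\<And>A. A \<subseteq> {1..n} \<Longrightarrow> g A \<subseteq> {1..n}"
    and mon: "\<And>S. S \<in> F \<Longrightarrow> S \<subseteq> {1..n} \<Longrightarrow> (\<lambda>A. of_bool (S \<subseteq> g A)) \<in> polys n H"
  shows "(\<lambda>A. f (g A)) \<in> polys n H"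
proof -
  let ?h = "\<lambda>A. \<Sum>S\<in>Pow {1..n}. zeta f S * of_bool (S \<subseteq> g A)"
  have "(\<lambda>A. zeta f S * of_bool (S \<subseteq> g A)) \<in> polys n H" if "S \<in> Pow {1..n}" for S
  proof (cases "zeta f S = 0")
    case True
    then show ?thesis
      by (simp add: polys_zero)
  next
    case False
    then show ?thesis
      using mon[of S] polysD[OF f] that by simp
  qed
  then have "?h \<in> polys n H"
    by (intro polys_sum)
  moreover have "f (g A) = ?h A" if "A \<subseteq> {1..n}" for A
    using monomial_expansion[OF g[OF that]] .
  ultimately show ?thesis
    by (rule polys_cong[THEN iffD2, rotated])
qed

lemma polys_restrict:
  assumes f: "f \<in> polys n (Pow B)" and A: "A \<subseteq> {1..n}"
  shows "f (A \<inter> B) = f A"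
proof -
  have "f (A \<inter> B) = (\<Sum>S\<in>Pow {1..n}. zeta f S * of_bool (S \<subseteq> A \<inter> B))"
    using A by (intro monomial_expansion) auto
  also have "\<dots> = (\<Sum>S\<in>Pow {1..n}. zeta f S * of_bool (S \<subseteq> A))"
  proof (rule sum.cong[OF refl])
    fix S assume "S \<in> Pow {1..n}"
    then show "zeta f S * of_bool (S \<subseteq> A \<inter> B) = zeta f S * of_bool (S \<subseteq> A)"
      using polysD[OF f, of S] by (cases "zeta f S = 0") auto
  qed
  also have "\<dots> = f A"
    using monomial_expansion[OF A] by simp
  finally show ?thesis .
qed

lemma polys_extend:
  assumes f: "f \<in> polys m F" and "m \<le> n" "F \<subseteq> Pow {1..m}"
  shows "(\<lambda>A. f (A \<inter> {1..m})) \<in> polys n F"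
proof (rule polysI[where c = "\<lambda>S. if S \<subseteq> {1..m} then zeta f S else 0"])
  fix A assume A: "A \<subseteq> {1..n}"
  let ?c = "\<lambda>S. if S \<subseteq> {1..m} then zeta f S else 0"
  have "f (A \<inter> {1..m}) = zeta (zeta f) (A \<inter> {1..m})"
    by (simp add: zeta_zeta)
  also have "\<dots> = (\<Sum>S\<in>Pow (A \<inter> {1..m}). ?c S)"
    unfolding zeta_def[of "zeta f"] by (rule sum.cong) auto
  also have "\<dots> = zeta ?c A"
    unfolding zeta_def[of ?c] by (rule sum.mono_neutral_left) (use A finite_cube in auto)
  finally show "f (A \<inter> {1..m}) = zeta ?c A" .
qed (use polysD[OF f] in \<open>auto split: if_splits\<close>)

lemma polys_fewer_variables:
  assumes "f \<in> polys n F" "m \<le> n"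
  shows "f \<in> polys m F"
  unfolding polys_def
proof (intro CollectI allI impI)
  fix S assume S: "S \<subseteq> {1..m}" "zeta f S \<noteq> 0"
  then have "S \<subseteq> {1..n}"
    using assms(2) by fastforce
  then show "S \<in> F"
    using polysD[OF assms(1)] S(2) by blast
qed

lemma polys_PowI:
  assumes "\<And>A. A \<subseteq> {1..n} \<Longrightarrow> f (A \<inter> {1..m}) = f A" "m \<le> n"
  shows "f \<in> polys n (Pow {1..m})"
proof -
  have "f \<in> polys m (Pow {1..m})"
    by (auto simp: polys_def)
  then have "(\<lambda>A. f (A \<inter> {1..m})) \<in> polys n (Pow {1..m})"
    by (rule polys_extend) (use assms(2) in auto)
  then show ?thesis
    by (rule polys_cong[THEN iffD1, rotated]) (rule assms(1))
qed

section \<open>Maps whose coordinate shifts have bounded weight\<close>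

definition coord :: "nat \<Rightarrow> nat set \<Rightarrow> bit" where
  "coord i A = of_bool (i \<in> A)"

text \<open>
  In characteristic 2 the sum of old and new coordinate is the change, so a map sends \<open>x_i\<close> to
  \<open>x_i + shift g i x\<close>.
\<close>

definition shift :: "(nat set \<Rightarrow> nat set) \<Rightarrow> nat \<Rightarrow> nat set \<Rightarrow> bit" where
  "shift g i A = coord i (g A) + coord i A"

lemma coord_image: "coord i (g A) = coord i A + shift g i A"
  by (simp add: shift_def add.left_commute)

lemma shift_comp: "shift (\<lambda>A. g (h A)) i A = shift g i (h A) + shift h i A"
  by (simp add: shift_def add.assoc)

lemma coord_eqI:
  assumes "A \<subseteq> {1..n}" "B \<subseteq> {1..n}" "\<And>i. i \<in> {1..n} \<Longrightarrow> coord i A = coord i B"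
  shows "A = B"
  using assms by (fastforce simp: coord_def split: if_splits)

lemma coord_eq_iff: "coord i A = coord j B \<longleftrightarrow> (i \<in> A \<longleftrightarrow> j \<in> B)"
  by (auto simp: coord_def)

text \<open>
  Give the monomial of \<open>S\<close> in the \<open>i\<close>-th shift the weight \<open>\<Sum>S + (n - i)\<close>. Besides the monomials
  of degree at most 1, those of weight at most \<open>c\<close> are admissible; the weight condition is
  written without truncated subtraction. The weight is designed so that replacing a coordinate
  \<open>x_j\<close> in \<open>S\<close> by some \<open>x_l\<close> with \<open>l < j\<close>, dropping it, or passing from \<open>i\<close> to a larger index
  lowers the weight: these are the effects of a commutator with an affine triangular map.
\<close>

definition adm :: "nat \<Rightarrow> nat \<Rightarrow> nat \<Rightarrow> nat set set" where
  "adm n c i = {S. S \<subseteq> {1..<i} \<and> (card S \<le> 1 \<or> \<Sum>S + n \<le> c + i)}"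

text \<open>
  For \<open>2 \<le> c \<le> n\<close> these maps will turn out to form the member \<open>c - 2\<close> of the normalizer chain.
\<close>

definition chain :: "nat \<Rightarrow> nat \<Rightarrow> (nat set \<Rightarrow> nat set) set" where
  "chain n c = {g. (\<forall>A\<subseteq>{1..n}. g A \<subseteq> {1..n}) \<and> (\<forall>i\<in>{1..n}. shift g i \<in> polys n (adm n c i))}"

lemma chain_maps: "g \<in> chain n c \<Longrightarrow> A \<subseteq> {1..n} \<Longrightarrow> g A \<subseteq> {1..n}"
  by (simp add: chain_def)

lemma chain_shift: "g \<in> chain n c \<Longrightarrow> i \<in> {1..n} \<Longrightarrow> shift g i \<in> polys n (adm n c i)"
  by (simp add: chain_def)

lemma chainI:
  assumes "\<And>A. A \<subseteq> {1..n} \<Longrightarrow> g A \<subseteq> {1..n}"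
    and "\<And>i. i \<in> {1..n} \<Longrightarrow> shift g i \<in> polys n (adm n c i)"
  shows "g \<in> chain n c"
  using assms by (simp add: chain_def)

lemma chain_cong:
  assumes "\<And>A. A \<subseteq> {1..n} \<Longrightarrow> g A = h A"
  shows "g \<in> chain n c \<longleftrightarrow> h \<in> chain n c"
proof -
  have "shift g i \<in> polys n F \<longleftrightarrow> shift h i \<in> polys n F" for i F
    by (rule polys_cong) (simp add: shift_def assms)
  then show ?thesis
    using assms by (simp add: chain_def)
qed

lemma adm_subset: "S \<in> adm n c i \<Longrightarrow> S \<subseteq> {1..<i}"
  by (simp add: adm_def)

lemma empty_in_adm: "{} \<in> adm n c i"
  by (simp add: adm_def)

lemma singleton_in_adm: "j \<in> {1..<i} \<Longrightarrow> {j} \<in> adm n c i"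
  by (simp add: adm_def)

lemma adm_mono: "c \<le> d \<Longrightarrow> adm n c i \<subseteq> adm n d i"
  by (auto simp: adm_def)

lemma card_le_1_cases:
  assumes "finite S" "card S \<le> 1"
  obtains "S = {}" | j where "S = {j}"
  using assms by (metis One_nat_def card_0_eq card_1_singletonE le_SucE le_zero_eq)

text \<open>
  This is where \<open>c \<le> n\<close> matters: a monomial that a map of the chain adds to \<open>x_j\<close> has index sum
  at most \<open>j\<close>, so substituting it for \<open>x_j\<close> never raises the weight, and for \<open>c < n\<close> it even
  lowers it.
\<close>

lemma adm_sum_le:
  assumes "S \<in> adm n c i" "c \<le> n"
  shows "\<Sum>S \<le> i"
proof (cases "card S \<le> 1")
  case True
  have "finite S"
    using assms(1) by (auto simp: adm_def intro: finite_subset)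
  then show ?thesis
    using True assms(1) by (elim card_le_1_cases) (auto simp: adm_def)
qed (use assms in \<open>auto simp: adm_def\<close>)

lemma adm_sum_less:
  assumes "S \<in> adm n c i" "c < n" "0 < i"
  shows "\<Sum>S < i"
proof (cases "card S \<le> 1")
  case True
  have "finite S"
    using assms(1) by (auto simp: adm_def intro: finite_subset)
  then show ?thesis
    using True assms by (elim card_le_1_cases) (auto simp: adm_def)
qed (use assms in \<open>auto simp: adm_def\<close>)

text \<open>
  A set of at least two positive numbers has sum at least 3, so the bound 2 leaves affine shifts
  only.
\<close>

lemma adm_2:
  assumes "i \<le> n"
  shows "adm n 2 i = {S. S \<subseteq> {1..<i} \<and> card S \<le> 1}"
proof -
  have False if S: "S \<subseteq> {1..<i}" "\<not> card S \<le> 1" "\<Sum>S + n \<le> 2 + i" for S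
  proof -
    have fin: "finite S"
      using S(1) by (rule finite_subset) auto
    then obtain T where T: "T \<subseteq> S" "card T = 2"
      using S(2) obtain_subset_with_card_n[of 2 S] by auto
    then obtain a b where "T = {a, b}" "a \<noteq> b"
      by (meson card_2_iff)
    moreover have "\<Sum>T \<le> \<Sum>S"
      using T(1) fin by (intro sum_mono2) auto
    ultimately have "a + b \<le> 2"
      using S(3) assms by simp
    moreover have "1 \<le> a" "1 \<le> b"
      using \<open>T = {a, b}\<close> T(1) S(1) by auto
    ultimately show False
      using \<open>a \<noteq> b\<close> by linarith
  qed
  then show ?thesis
    by (auto simp: adm_def)
qed

text \<open>
  Forgetting the last coordinate lowers \<open>n\<close> by one and hence every weight by one. For \<open>c = 0\<close>
  the truncated \<open>c - 1\<close> is harmless, as both sides then consist of the monomials of degree at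
  most 1.
\<close>

lemma adm_Suc:
  assumes "i \<le> n"
  shows "adm (Suc n) c i = adm n (c - 1) i"
proof (cases c)
  case 0
  have "card S \<le> 1" if "S \<subseteq> {1..<i}" "\<Sum>S + n \<le> i" for S
  proof -
    have "\<Sum>S = 0" "finite S"
      using that assms by (auto intro: finite_subset)
    then have "S = {}"
      using that(1) by fastforce
    then show ?thesis
      by simp
  qed
  then show ?thesis
    using 0 assms by (auto simp: adm_def)
qed (simp add: adm_def)

text \<open>
  The bound is strict so that it is met by no monomial for \<open>w = 0\<close>: the difference in
  \<open>monomial_compose_diff\<close> vanishes for the empty monomial.
\<close>

definition lighter :: "nat \<Rightarrow> nat \<Rightarrow> nat set set" where
  "lighter i w = {S. S \<subseteq> {1..<i} \<and> \<Sum>S < w}"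

lemma adm_lighter_Suc: "S \<in> adm n c j \<Longrightarrow> c \<le> n \<Longrightarrow> j \<in> {1..<i} \<Longrightarrow> S \<in> lighter i (Suc j)"
  using adm_sum_le[of S n c j] adm_subset[of S n c j] by (fastforce simp: lighter_def)

lemma adm_lighter: "S \<in> adm n c j \<Longrightarrow> c < n \<Longrightarrow> j \<in> {1..<i} \<Longrightarrow> S \<in> lighter i j"
  using adm_sum_less[of S n c j] adm_subset[of S n c j] by (fastforce simp: lighter_def)

lemma sum_Un_le: "finite S \<Longrightarrow> finite T \<Longrightarrow> \<Sum>(S \<union> T) \<le> \<Sum>S + \<Sum>(T :: nat set)"
  using sum.union_inter[of S T "\<lambda>x. x"] by simp

lemma lighter_Un:
  assumes "S \<in> lighter i v" "T \<in> lighter i (Suc w)"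
  shows "S \<union> T \<in> lighter i (v + w)" "T \<union> S \<in> lighter i (v + w)"
proof -
  have fin: "finite S" "finite T"
    using assms by (auto simp: lighter_def intro: finite_subset)
  have "\<Sum>(S \<union> T) < v + w"
    using sum_Un_le[OF fin] assms by (simp add: lighter_def)
  then show "S \<union> T \<in> lighter i (v + w)" "T \<union> S \<in> lighter i (v + w)"
    using assms by (auto simp: lighter_def Un_commute)
qed

lemma coord_in_polys: "j \<in> {1..<i} \<Longrightarrow> coord j \<in> polys n (lighter i (Suc j))"
  using polys_monomial[of "{j}" "lighter i (Suc j)" n]
  by (simp add: lighter_def coord_def[abs_def])

lemma monomial_compose:
  assumes "S \<subseteq> {1..<i}"
    and "\<And>j. j \<in> S \<Longrightarrow> shift g j \<in> polys n (lighter i (Suc j))"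
  shows "(\<lambda>A. of_bool (S \<subseteq> g A)) \<in> polys n (lighter i (Suc (\<Sum>S)))"
proof -
  have "finite S"
    using assms(1) by (rule finite_subset) auto
  then show ?thesis
    using assms
  proof (induction S rule: finite_induct)
    case empty
    show ?case
      by (auto intro!: polys_const simp: lighter_def)
  next
    case (insert j S)
    have "coord j \<in> polys n (lighter i (Suc j))"
      using insert.prems by (intro coord_in_polys) auto
    then have "(\<lambda>A. (coord j A + shift g j A) * of_bool (S \<subseteq> g A))
        \<in> polys n (lighter i (Suc j + \<Sum>S))"
      using insert.prems insert.IH
      by (intro polys_mult[of _ n "lighter i (Suc j)" _ "lighter i (Suc (\<Sum>S))"]
                polys_add lighter_Un) auto
    moreover have "of_bool (insert j S \<subseteq> g A) = (coord j A + shift g j A) * of_bool (S \<subseteq> g A)" for A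
      by (simp add: coord_image[symmetric]) (simp add: coord_def)
    ultimately show ?case
      using insert.hyps by simp
  qed
qed

text \<open>
  By induction on \<open>S\<close>, from the identity \<open>(x + s) P' - x P = s P' + x (P' - P)\<close>, in which both
  summands on the right are lighter than \<open>x P\<close>.
\<close>

lemma monomial_compose_diff:
  assumes "S \<subseteq> {1..<i}"
    and "\<And>j. j \<in> S \<Longrightarrow> shift g j \<in> polys n (lighter i j)"
  shows "(\<lambda>A. of_bool (S \<subseteq> g A) + of_bool (S \<subseteq> A)) \<in> polys n (lighter i (\<Sum>S))"
proof -
  have "finite S"
    using assms(1) by (rule finite_subset) auto
  then show ?thesis
    using assms
  proof (induction S rule: finite_induct)
    case empty
    show ?case
      by (simp add: polys_zero)
  next
    case (insert j S)
    have j: "coord j \<in> polys n (lighter i (Suc j))"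
      using insert.prems by (intro coord_in_polys) auto
    have "(\<lambda>A. of_bool (S \<subseteq> g A)) \<in> polys n (lighter i (Suc (\<Sum>S)))"
    proof (rule monomial_compose)
      fix l assume "l \<in> S"
      then show "shift g l \<in> polys n (lighter i (Suc l))"
        using insert.prems(2)[of l] by (intro polys_mono[of _ n "lighter i l" "lighter i (Suc l)"]) (auto simp: lighter_def)
    qed (use insert.prems in auto)
    then have 1: "(\<lambda>A. shift g j A * of_bool (S \<subseteq> g A)) \<in> polys n (lighter i (j + \<Sum>S))"
      using insert.prems
      by (intro polys_mult[of _ n "lighter i j" _ "lighter i (Suc (\<Sum>S))"] lighter_Un) auto
    have 2: "(\<lambda>A. coord j A * (of_bool (S \<subseteq> g A) + of_bool (S \<subseteq> A))) \<in> polys n (lighter i (\<Sum>S + j))"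
      using insert
      by (intro polys_mult[OF j, of _ "lighter i (\<Sum>S)"] lighter_Un) auto
    have eq: "of_bool (insert j S \<subseteq> g A) + of_bool (insert j S \<subseteq> A)
        = shift g j A * of_bool (S \<subseteq> g A) + coord j A * (of_bool (S \<subseteq> g A) + of_bool (S \<subseteq> A))" for A
      by (simp add: shift_def coord_def)
    show ?case
      using polys_add[OF 1 2[unfolded add.commute[of _ j]]]
      by (simp only: eq sum.insert[OF insert.hyps])
  qed
qed

text \<open>
  The map may belong to the next member of the chain, \<open>d = Suc c\<close>: a linear monomial \<open>x_j\<close> with
  \<open>j < i\<close> turns into the \<open>j\<close>-th shift of \<open>g\<close>, whose monomials lose the superfluous unit of
  weight when they move from index \<open>j\<close> to index \<open>i\<close>.
\<close>

lemma polys_adm_compose: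
  assumes f: "f \<in> polys n (adm n c i)"
    and g: "\<And>A. A \<subseteq> {1..n} \<Longrightarrow> g A \<subseteq> {1..n}"
      "\<And>j. j \<in> {1..<i} \<Longrightarrow> shift g j \<in> polys n (adm n d j)"
    and d: "d \<le> n" "d \<le> Suc c"
  shows "(\<lambda>A. f (g A)) \<in> polys n (adm n c i)"
proof (rule polys_compose[OF f g(1)])
  fix S assume S: "S \<in> adm n c i" "S \<subseteq> {1..n}"
  show "(\<lambda>A. of_bool (S \<subseteq> g A)) \<in> polys n (adm n c i)"
  proof (cases "card S \<le> 1")
    case True
    from S(2) have "finite S"
      by (rule finite_subset) auto
    then show ?thesis
      using True
    proof (cases rule: card_le_1_cases)
      case 1
      then show ?thesis
        by (auto intro: polys_const empty_in_adm)
    next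
      case (2 j)
      then have j: "j \<in> {1..<i}"
        using adm_subset[OF S(1)] by auto
      have "shift g j \<in> polys n (adm n c i)"
        using g(2)[OF j] by (rule polys_mono) (use j d in \<open>auto simp: adm_def\<close>)
      moreover have "coord j \<in> polys n (adm n c i)"
        using polys_monomial[OF singleton_in_adm[OF j], of n n c] by (simp add: coord_def[abs_def])
      ultimately have "(\<lambda>A. coord j A + shift g j A) \<in> polys n (adm n c i)"
        by (rule polys_add[rotated])
      then show ?thesis
        using 2 by (simp add: coord_image[symmetric]) (simp add: coord_def)
    qed
  next
    case False
    have "(\<lambda>A. of_bool (S \<subseteq> g A)) \<in> polys n (lighter i (Suc (\<Sum>S)))"
    proof (rule monomial_compose)
      fix j assume "j \<in> S"
      then have j: "j \<in> {1..<i}"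
        using adm_subset[OF S(1)] by auto
      show "shift g j \<in> polys n (lighter i (Suc j))"
        using g(2)[OF j] by (rule polys_mono) (rule adm_lighter_Suc[OF _ d(1) j])
    qed (use adm_subset[OF S(1)] in auto)
    then show ?thesis
      by (rule polys_mono) (use S(1) False in \<open>auto simp: adm_def lighter_def\<close>)
  qed
qed

lemma chain_comp:
  assumes "g \<in> chain n c" "h \<in> chain n c" "c \<le> n"
  shows "(\<lambda>A. g (h A)) \<in> chain n c"
proof (rule chainI)
  fix i assume i: "i \<in> {1..n}"
  have "(\<lambda>A. shift g i (h A)) \<in> polys n (adm n c i)"
    using chain_shift[OF assms(1) i] chain_maps[OF assms(2)]
    by (rule polys_adm_compose[where d = c]) (use assms i in \<open>simp_all add: chain_shift\<close>)
  then have "(\<lambda>A. shift g i (h A) + shift h i A) \<in> polys n (adm n c i)"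
    using chain_shift[OF assms(2) i] by (rule polys_add)
  then show "shift (\<lambda>A. g (h A)) i \<in> polys n (adm n c i)"
    by (simp add: shift_comp[abs_def])
qed (rule chain_maps[OF assms(1) chain_maps[OF assms(2)]])

text \<open>
  The heart of the inclusion of the next member of the chain into the normalizer: a commutator
  with \<open>h\<close> replaces at least one factor \<open>x_j\<close> of a monomial by a shift of \<open>h\<close>, whose monomials
  have index sum less than \<open>j\<close>, and so costs at least one unit of weight.
\<close>

lemma shift_compose_diff:
  assumes f: "f \<in> polys n (adm n (Suc c) i)" and h: "h \<in> chain n c" and c: "c < n" and i: "i \<le> n"
  shows "(\<lambda>A. f (h A) + f A) \<in> polys n (adm n c i)"
proof -
  let ?e = "\<lambda>S A. zeta f S * (of_bool (S \<subseteq> h A) + of_bool (S \<subseteq> A))"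
  have "?e S \<in> polys n (adm n c i)" if S: "S \<in> Pow {1..n}" for S
  proof (cases "zeta f S = 0")
    case True
    then show ?thesis
      by (simp add: polys_zero)
  next
    case False
    then have adm: "S \<in> adm n (Suc c) i"
      using polysD[OF f] S by auto
    have sub: "j \<in> {1..<i}" if "j \<in> S" for j
      using adm_subset[OF adm] that by auto
    have "(\<lambda>A. of_bool (S \<subseteq> h A) + of_bool (S \<subseteq> A)) \<in> polys n (adm n c i)"
    proof (cases "card S \<le> 1")
      case True
      from S have "finite S"
        by (auto intro: finite_subset)
      then show ?thesis
        using True
      proof (cases rule: card_le_1_cases)
        case 1
        then show ?thesis
          by (simp add: polys_zero)
      next
        case (2 j)
        then have j: "j \<in> {1..<i}"
          using sub[of j] by simp
        have "shift h j \<in> polys n (adm n c j)"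
          using j i by (intro chain_shift[OF h]) auto
        then have "shift h j \<in> polys n (adm n c i)"
          by (rule polys_mono) (use j in \<open>auto simp: adm_def\<close>)
        then show ?thesis
          using 2 by (simp add: shift_def[abs_def] coord_def)
      qed
    next
      case False
      have "(\<lambda>A. of_bool (S \<subseteq> h A) + of_bool (S \<subseteq> A)) \<in> polys n (lighter i (\<Sum>S))"
      proof (rule monomial_compose_diff)
        fix j assume j: "j \<in> S"
        show "shift h j \<in> polys n (lighter i j)"
        proof (rule polys_mono)
          show "shift h j \<in> polys n (adm n c j)"
            using sub[OF j] i by (intro chain_shift[OF h]) auto
        qed (rule adm_lighter[OF _ c sub[OF j]])
      qed (use sub in auto)
      then show ?thesis
        by (rule polys_mono) (use adm False in \<open>auto simp: adm_def lighter_def\<close>)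
    qed
    then show ?thesis
      using False by simp
  qed
  then have "(\<lambda>A. \<Sum>S\<in>Pow {1..n}. ?e S A) \<in> polys n (adm n c i)"
    by (rule polys_sum)
  moreover have "f (h A) + f A = (\<Sum>S\<in>Pow {1..n}. ?e S A)" if A: "A \<subseteq> {1..n}" for A
    unfolding monomial_expansion[OF A, of f] monomial_expansion[OF chain_maps[OF h A], of f]
    by (simp add: distrib_left sum.distrib)
  ultimately show ?thesis
    by (rule polys_cong[THEN iffD2, rotated])
qed

section \<open>Maps normalizing a member of the chain\<close>

definition transvection :: "nat \<Rightarrow> nat \<Rightarrow> nat set \<Rightarrow> nat set" where
  "transvection j l A = (if l \<in> A then sym_diff A {j} else A)"

lemma coord_sym_diff: "coord i (sym_diff A B) = coord i A + coord i B"
  by (simp add: coord_def)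

lemma shift_translation: "shift (\<lambda>A. sym_diff A B) i = (\<lambda>A. coord i B)"
  by (rule ext) (simp add: shift_def coord_sym_diff add.commute)

lemma translation_in_chain:
  assumes "B \<subseteq> {1..n}"
  shows "(\<lambda>A. sym_diff A B) \<in> chain n c"
proof (rule chainI)
  fix A assume "A \<subseteq> {1..n}"
  then show "sym_diff A B \<subseteq> {1..n}"
    using assms by blast
qed (simp only: shift_translation polys_const empty_in_adm)

lemma shift_transvection: "shift (transvection j l) i = (if i = j then coord l else (\<lambda>A. 0))"
  by (auto simp: shift_def transvection_def coord_def fun_eq_iff)

lemma coord_in_adm_polys: "l \<in> {1..<i} \<Longrightarrow> coord l \<in> polys n (adm n c i)"
  using polys_monomial[OF singleton_in_adm[of l i n c], of n] by (simp add: coord_def[abs_def])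

lemma transvection_in_chain:
  assumes "j \<in> {1..n}" "l \<in> {1..<j}"
  shows "transvection j l \<in> chain n c"
proof (rule chainI)
  show "transvection j l A \<subseteq> {1..n}" if "A \<subseteq> {1..n}" for A
    using that assms by (auto simp: transvection_def)
  show "shift (transvection j l) i \<in> polys n (adm n c i)" for i
    using assms coord_in_adm_polys[OF assms(2)] by (simp add: shift_transvection polys_zero)
qed

text \<open>
  Normalization by conjugation, in terms of maps on points that need be defined on subsets of
  \<open>{1..n}\<close> only. Stating both inclusions lets the property pass to the quotient in
  \<open>normalizer_descends\<close>.
\<close>

definition normalizes :: "nat \<Rightarrow> (nat set \<Rightarrow> nat set) set \<Rightarrow> (nat set \<Rightarrow> nat set) \<Rightarrow> bool" where
  "normalizes n M g \<longleftrightarrow> bij_betw g (Pow {1..n}) (Pow {1..n})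
     \<and> (\<forall>h\<in>M. \<exists>m\<in>M. \<forall>A\<subseteq>{1..n}. g (h A) = m (g A))
     \<and> (\<forall>m\<in>M. \<exists>h\<in>M. \<forall>A\<subseteq>{1..n}. g (h A) = m (g A))"

lemma normalizes_maps: "normalizes n M g \<Longrightarrow> A \<subseteq> {1..n} \<Longrightarrow> g A \<subseteq> {1..n}"
  by (auto simp: normalizes_def dest: bij_betwE)

lemma normalizes_inj:
  "normalizes n M g \<Longrightarrow> g A = g B \<Longrightarrow> A \<subseteq> {1..n} \<Longrightarrow> B \<subseteq> {1..n} \<Longrightarrow> A = B"
  by (auto simp: normalizes_def bij_betw_def dest: inj_onD)

lemma normalizes_surj:
  assumes "normalizes n M g" "B \<subseteq> {1..n}"
  obtains A where "A \<subseteq> {1..n}" "g A = B"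
proof -
  have "B \<in> g ` Pow {1..n}"
    using assms by (simp add: normalizes_def bij_betw_def)
  then show ?thesis
    using that by auto
qed

lemma normalizes_fwd:
  assumes "normalizes n M g" "h \<in> M"
  obtains m where "m \<in> M" "\<And>A. A \<subseteq> {1..n} \<Longrightarrow> g (h A) = m (g A)"
  using assms unfolding normalizes_def by metis

lemma normalizes_bwd:
  assumes "normalizes n M g" "m \<in> M"
  obtains h where "h \<in> M" "\<And>A. A \<subseteq> {1..n} \<Longrightarrow> g (h A) = m (g A)"
  using assms unfolding normalizes_def by metis

lemma chain_restrict:
  assumes "h \<in> chain n c" "A \<subseteq> {1..n}" "i \<in> {1..n}"
  shows "shift h i (A \<inter> {1..<i}) = shift h i A"
proof (rule polys_restrict[OF _ assms(2)])
  show "shift h i \<in> polys n (Pow {1..<i})"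
    using chain_shift[OF assms(1,3)] by (rule polys_mono) (intro PowI adm_subset)
qed

lemma chain_commutes_top_flip:
  assumes h: "h \<in> chain (Suc n) c" and A: "A \<subseteq> {1..Suc n}"
  shows "h (sym_diff A {Suc n}) = sym_diff (h A) {Suc n}"
proof -
  let ?N = "Suc n"
  have A': "sym_diff A {?N} \<subseteq> {1..?N}"
    using A by auto
  show ?thesis
  proof (rule coord_eqI)
    show "sym_diff (h A) {?N} \<subseteq> {1..?N}"
      using chain_maps[OF h A] by auto
    fix i assume i: "i \<in> {1..?N}"
    have "sym_diff A {?N} \<inter> {1..<i} = A \<inter> {1..<i}"
      using i by auto
    then have "shift h i (sym_diff A {?N}) = shift h i A"
      using chain_restrict[OF h A i] chain_restrict[OF h A' i] by simp
    then show "coord i (h (sym_diff A {?N})) = coord i (sym_diff (h A) {?N})"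
      by (simp only: coord_image[of i h] coord_sym_diff ac_simps)
  qed (rule chain_maps[OF h A'])
qed

text \<open>
  Apart from the identity, the flip of the last coordinate is the only element of
  \<open>chain (Suc n) c\<close> that commutes with all the others: a map commuting with all translations is
  a translation, by \<open>v\<close> say, and commuting with the map that adds \<open>x_l\<close> to the last coordinate
  forces \<open>l \<notin> v\<close>. A normalizing map therefore fixes this flip under conjugation.
\<close>

lemma normalizer_commutes_top_flip:
  assumes g: "normalizes (Suc n) (chain (Suc n) c) g" and A: "A \<subseteq> {1..Suc n}"
  shows "g (sym_diff A {Suc n}) = sym_diff (g A) {Suc n}"
proof -
  let ?N = "Suc n"
  have flip: "sym_diff A {?N} \<subseteq> {1..?N}" if "A \<subseteq> {1..?N}" for A
    using that by auto
  have "(\<lambda>A. sym_diff A {?N}) \<in> chain ?N c"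
    by (rule translation_in_chain) auto
  with g obtain z where z: "z \<in> chain ?N c"
    "\<And>A. A \<subseteq> {1..?N} \<Longrightarrow> g (sym_diff A {?N}) = z (g A)"
    by (rule normalizes_fwd) (rule that)
  have comm: "z (m B) = m (z B)" if m: "m \<in> chain ?N c" and B: "B \<subseteq> {1..?N}" for m B
  proof -
    obtain h where h: "h \<in> chain ?N c" "\<And>A. A \<subseteq> {1..?N} \<Longrightarrow> g (h A) = m (g A)"
      using g m by (rule normalizes_bwd) (rule that)
    obtain A where A: "A \<subseteq> {1..?N}" "g A = B"
      using g B by (rule normalizes_surj) (rule that)
    have "z (m B) = z (g (h A))"
      using h A by simp
    also have "\<dots> = g (sym_diff (h A) {?N})"
      using z(2) chain_maps[OF h(1) A(1)] by simp
    also have "\<dots> = g (h (sym_diff A {?N}))"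
      by (simp only: chain_commutes_top_flip[OF h(1) A(1)])
    also have "\<dots> = m (z B)"
      using h(2)[OF flip[OF A(1)]] z(2)[OF A(1)] A(2) by simp
    finally show ?thesis .
  qed
  \<comment> \<open>A map commuting with all translations is determined by its value at the origin.\<close>
  define v where "v = z {}"
  have zv: "z B = sym_diff B v" if B: "B \<subseteq> {1..?N}" for B
    using comm[OF translation_in_chain[OF B], of "{}"] by (auto simp: v_def)
  have v: "v \<subseteq> {1..?N}"
    unfolding v_def by (rule chain_maps[OF z(1)]) simp
  have "l \<notin> v" if l: "l \<in> {1..<?N}" for l
  proof
    assume "l \<in> v"
    have "transvection ?N l \<in> chain ?N c"
      using l by (intro transvection_in_chain) auto
    then have "z (transvection ?N l {}) = transvection ?N l (z {})"
      by (rule comm) simp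
    with \<open>l \<in> v\<close> have "v = sym_diff v {?N}"
      by (simp add: transvection_def v_def)
    then show False
      by blast
  qed
  moreover have "v \<noteq> {}"
  proof
    assume "v = {}"
    then have "g (sym_diff {} {?N}) = g {}"
      using z(2)[of "{}"] zv[of "g {}"] normalizes_maps[OF g, of "{}"] by simp
    then have "sym_diff {} {?N} = {}"
      by (rule normalizes_inj[OF g]) auto
    then show False
      by simp
  qed
  moreover have "l = ?N" if "l \<in> v" "l \<notin> {1..<?N}" for l
    using subsetD[OF v that(1)] that(2) by simp
  ultimately have "v = {?N}"
    by blast
  then show ?thesis
    using z(2)[OF A] zv[OF normalizes_maps[OF g A]] by simp
qed

lemma sym_diff_top_Int: "sym_diff B {Suc n} \<inter> {1..n} = B \<inter> {1..n}"
  by auto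

lemma descends_if_commutes_top_flip:
  assumes comm: "f (sym_diff A {Suc n}) = sym_diff (f A) {Suc n}" and A: "A \<subseteq> {1..Suc n}"
  shows "f A \<inter> {1..n} = f (A \<inter> {1..n}) \<inter> {1..n}"
proof (cases "Suc n \<in> A")
  case True
  then have "A \<inter> {1..n} = sym_diff A {Suc n}"
    using A by auto
  then show ?thesis
    by (simp only: comm sym_diff_top_Int)
next
  case False
  then have "A \<inter> {1..n} = A"
    using A by (force simp: le_Suc_eq)
  then show ?thesis
    by simp
qed

lemma normalizer_descends_eq:
  assumes "normalizes (Suc n) (chain (Suc n) c) g" "A \<subseteq> {1..Suc n}"
  shows "g A \<inter> {1..n} = g (A \<inter> {1..n}) \<inter> {1..n}"
  by (rule descends_if_commutes_top_flip[OF normalizer_commutes_top_flip[OF assms] assms(2)])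

lemma chain_descends_eq:
  assumes "h \<in> chain (Suc n) c" "A \<subseteq> {1..Suc n}"
  shows "h A \<inter> {1..n} = h (A \<inter> {1..n}) \<inter> {1..n}"
  by (rule descends_if_commutes_top_flip[OF chain_commutes_top_flip[OF assms] assms(2)])

lemma adm_subset_Pow: "i \<in> {1..m} \<Longrightarrow> adm n c i \<subseteq> Pow {1..m}"
  by (force simp: adm_def)

lemma chain_descends:
  assumes h: "h \<in> chain (Suc n) c"
  shows "(\<lambda>A. h A \<inter> {1..n}) \<in> chain n (c - 1)"
proof (rule chainI)
  fix i assume i: "i \<in> {1..n}"
  have "shift h i \<in> polys (Suc n) (adm (Suc n) c i)"
    using i by (intro chain_shift[OF h]) auto
  then have "shift h i \<in> polys (Suc n) (adm n (c - 1) i)"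
    using i adm_Suc[of i n c] by simp
  then have "shift h i \<in> polys n (adm n (c - 1) i)"
    by (rule polys_fewer_variables) simp
  moreover have "shift (\<lambda>A. h A \<inter> {1..n}) i = shift h i"
    using i by (simp add: shift_def coord_def fun_eq_iff)
  ultimately show "shift (\<lambda>A. h A \<inter> {1..n}) i \<in> polys n (adm n (c - 1) i)"
    by (simp only:)
qed auto

lemma chain_lifts:
  assumes h: "h \<in> chain n (c - 1)"
  shows "(\<lambda>A. h (A \<inter> {1..n}) \<union> (A \<inter> {Suc n})) \<in> chain (Suc n) c" (is "?h \<in> _")
proof (rule chainI)
  have hm: "h (A \<inter> {1..n}) \<subseteq> {1..n}" for A
    by (rule chain_maps[OF h]) auto
  show "?h A \<subseteq> {1..Suc n}" for A
    using hm[of A] by fastforce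
  fix i assume i: "i \<in> {1..Suc n}"
  show "shift ?h i \<in> polys (Suc n) (adm (Suc n) c i)"
  proof (cases "i = Suc n")
    case True
    have "shift ?h i A = 0" for A
    proof -
      have "i \<notin> h (A \<inter> {1..n})"
        using hm[of A] True by fastforce
      then show ?thesis
        using True by (simp add: shift_def coord_def)
    qed
    then have "shift ?h i = (\<lambda>A. 0)"
      by (rule ext)
    then show ?thesis
      by (simp only: polys_zero)
  next
    case False
    with i have i: "i \<in> {1..n}"
      by auto
    have "(\<lambda>A. shift h i (A \<inter> {1..n})) \<in> polys (Suc n) (adm n (c - 1) i)"
      using chain_shift[OF h i] by (rule polys_extend) (simp, rule adm_subset_Pow[OF i])
    moreover have "shift ?h i = (\<lambda>A. shift h i (A \<inter> {1..n}))"
      using i by (simp add: shift_def coord_def fun_eq_iff)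
    moreover have "adm (Suc n) c i = adm n (c - 1) i"
      using i by (intro adm_Suc) simp
    ultimately show ?thesis
      by (simp only:)
  qed
qed

lemma equal_or_top_flip:
  assumes "A \<subseteq> {1..Suc n}" "B \<subseteq> {1..Suc n}" "A \<inter> {1..n} = B \<inter> {1..n}"
  shows "A = B \<or> A = sym_diff B {Suc n}"
proof -
  have *: "A = B \<or> A = sym_diff B {a}"
    if "A \<subseteq> insert a X" "B \<subseteq> insert a X" "A \<inter> X = B \<inter> X" for a and X :: "nat set"
    using that by blast
  have "{1..Suc n} = insert (Suc n) {1..n}"
    by auto
  then show ?thesis
    using assms *[of "Suc n" "{1..n}"] by simp
qed

text \<open>
  As the flip of the last coordinate commutes with everything in sight, forgetting the last
  coordinate turns \<open>g\<close> into a map in one coordinate less, normalizing the quotient of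
  \<open>chain (Suc n) c\<close>, which is \<open>chain n (c - 1)\<close>.
\<close>

lemma normalizer_descends:
  assumes g: "normalizes (Suc n) (chain (Suc n) c) g"
  shows "normalizes n (chain n (c - 1)) (\<lambda>A. g A \<inter> {1..n})" (is "normalizes n _ ?g")
  unfolding normalizes_def
proof (intro conjI ballI)
  have up: "A \<subseteq> {1..Suc n}" if "A \<subseteq> {1..n}" for A
    using that by auto
  have "inj_on ?g (Pow {1..n})"
  proof (rule inj_onI)
    fix A B assume A: "A \<in> Pow {1..n}" and B: "B \<in> Pow {1..n}" and eq: "?g A = ?g B"
    have sub: "g A \<subseteq> {1..Suc n}" "g B \<subseteq> {1..Suc n}"
      using A B normalizes_maps[OF g up] by auto
    show "A = B"
    proof (cases "g A = g B")
      case True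
      then show ?thesis
        using A B normalizes_inj[OF g] up by auto
    next
      case False
      then have "g A = sym_diff (g B) {Suc n}"
        using equal_or_top_flip[OF sub eq] by simp
      then have "g A = g (sym_diff B {Suc n})"
        using normalizer_commutes_top_flip[OF g up] B by simp
      then have "A = sym_diff B {Suc n}"
      proof (rule normalizes_inj[OF g])
        show "A \<subseteq> {1..Suc n}" "sym_diff B {Suc n} \<subseteq> {1..Suc n}"
          using A B by auto
      qed
      moreover have "Suc n \<notin> A" "Suc n \<notin> B"
        using A B by auto
      ultimately show ?thesis
        by blast
    qed
  qed
  then show "bij_betw ?g (Pow {1..n}) (Pow {1..n})"
    unfolding bij_betw_def by (intro conjI endo_inj_surj) auto
next
  fix h assume h: "h \<in> chain n (c - 1)"
  let ?h = "\<lambda>A. h (A \<inter> {1..n}) \<union> (A \<inter> {Suc n})"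
  obtain m where m: "m \<in> chain (Suc n) c" "\<And>A. A \<subseteq> {1..Suc n} \<Longrightarrow> g (?h A) = m (g A)"
    using g chain_lifts[OF h] by (rule normalizes_fwd) (rule that)
  show "\<exists>m\<in>chain n (c - 1). \<forall>A\<subseteq>{1..n}. ?g (h A) = m (?g A)"
  proof (intro bexI[OF _ chain_descends[OF m(1)]] allI impI)
    fix A :: "nat set" assume A: "A \<subseteq> {1..n}"
    then have A': "A \<subseteq> {1..Suc n}"
      by auto
    have "?h A = h A"
      using A by (auto simp: Int_absorb2)
    then have "g (h A) = m (g A)"
      using m(2)[OF A'] by simp
    then show "?g (h A) = m (?g A) \<inter> {1..n}"
      using chain_descends_eq[OF m(1) normalizes_maps[OF g A']] by simp
  qed
next
  fix m assume m: "m \<in> chain n (c - 1)"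
  let ?m = "\<lambda>A. m (A \<inter> {1..n}) \<union> (A \<inter> {Suc n})"
  obtain h where h: "h \<in> chain (Suc n) c" "\<And>A. A \<subseteq> {1..Suc n} \<Longrightarrow> g (h A) = ?m (g A)"
    using g chain_lifts[OF m] by (rule normalizes_bwd) (rule that)
  show "\<exists>h\<in>chain n (c - 1). \<forall>A\<subseteq>{1..n}. ?g (h A) = m (?g A)"
  proof (intro bexI[OF _ chain_descends[OF h(1)]] allI impI)
    fix A :: "nat set" assume A: "A \<subseteq> {1..n}"
    then have A': "A \<subseteq> {1..Suc n}"
      by auto
    have "?g (h A \<inter> {1..n}) = g (h A) \<inter> {1..n}"
      using normalizer_descends_eq[OF g chain_maps[OF h(1) A']] by simp
    also have "\<dots> = m (?g A) \<inter> {1..n}"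
      using h(2)[OF A'] by auto
    also have "\<dots> = m (?g A)"
      using chain_maps[OF m, of "?g A"] by auto
    finally show "?g (h A \<inter> {1..n}) = m (?g A)" .
  qed
qed

lemma normalizer_top_shift:
  assumes g: "normalizes (Suc n) (chain (Suc n) c) g" and A: "A \<subseteq> {1..Suc n}"
  shows "shift g (Suc n) (A \<inter> {1..n}) = shift g (Suc n) A"
proof (cases "Suc n \<in> A")
  case True
  then have eq: "A \<inter> {1..n} = sym_diff A {Suc n}"
    using A by auto
  then have "g (A \<inter> {1..n}) = sym_diff (g A) {Suc n}"
    using normalizer_commutes_top_flip[OF g A] by simp
  then show ?thesis
    unfolding shift_def by (simp only: eq coord_sym_diff) (simp add: ac_simps)
next
  case False
  then have "A \<inter> {1..n} = A"
    using A by (force simp: le_Suc_eq)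
  then show ?thesis
    by simp
qed

lemma shift_descends:
  assumes g: "normalizes (Suc n) (chain (Suc n) c) g" and A: "A \<subseteq> {1..Suc n}" and i: "i \<in> {1..n}"
  shows "shift (\<lambda>A. g A \<inter> {1..n}) i (A \<inter> {1..n}) = shift g i A"
proof -
  have "i \<in> g (A \<inter> {1..n}) \<longleftrightarrow> i \<in> g A"
    using normalizer_descends_eq[OF g A] i by blast
  then show ?thesis
    using i by (simp add: shift_def coord_def)
qed

lemma shift_lifts_polys:
  assumes g: "normalizes (Suc n) (chain (Suc n) c) g" and i: "i \<in> {1..n}"
    and d: "shift (\<lambda>A. g A \<inter> {1..n}) i \<in> polys n F" "F \<subseteq> Pow {1..n}"
  shows "shift g i \<in> polys (Suc n) F"
proof -
  have "(\<lambda>A. shift (\<lambda>A. g A \<inter> {1..n}) i (A \<inter> {1..n})) \<in> polys (Suc n) F"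
    using d(1) by (rule polys_extend) (use d(2) in auto)
  then show ?thesis
    by (rule polys_cong[THEN iffD1, rotated]) (rule shift_descends[OF g _ i])
qed

text \<open>
  By descent: at each stage the last shift does not depend on the last coordinate.
\<close>

lemma normalizer_triangular:
  assumes "normalizes n (chain n c) g" "i \<in> {1..n}"
  shows "shift g i \<in> polys n (Pow {1..<i})"
  using assms
proof (induction n arbitrary: c g i)
  case (Suc n)
  show ?case
  proof (cases "i = Suc n")
    case True
    have "shift g (Suc n) \<in> polys (Suc n) (Pow {1..n})"
      using normalizer_top_shift[OF Suc.prems(1)] by (rule polys_PowI) simp_all
    then show ?thesis
      using True by (simp add: atLeastLessThanSuc_atLeastAtMost)
  next
    case False
    with Suc.prems(2) have i: "i \<in> {1..n}"
      by auto
    show ?thesis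
      using Suc.IH[OF normalizer_descends[OF Suc.prems(1)] i]
      by (rule shift_lifts_polys[OF Suc.prems(1) i]) (use i in auto)
  qed
qed simp

text \<open>
  Coefficients of the differences of \<open>f\<close> along the two kinds of affine generators. A translation
  in \<open>x_j\<close> deletes \<open>j\<close> from a monomial, a transvection replaces \<open>j\<close> by \<open>l\<close> or, if \<open>l\<close> is already
  present, deletes \<open>j\<close>.
\<close>

lemma zeta_translation_diff:
  assumes "finite R" "j \<notin> R"
  shows "zeta (\<lambda>A. f (sym_diff A {j}) + f A) R = zeta f (insert j R)"
proof -
  have "zeta (\<lambda>A. f (sym_diff A {j}) + f A) R = zeta (\<lambda>A. f (insert j A) + f A) R"
  proof (rule zeta_cong)
    fix A assume "A \<subseteq> R"
    then have "sym_diff A {j} = insert j A"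
      using assms(2) by auto
    then show "f (sym_diff A {j}) + f A = f (insert j A) + f A"
      by simp
  qed
  then show ?thesis
    using assms by (simp add: zeta_insert zeta_add add.commute)
qed

lemma zeta_transvection_diff:
  assumes "finite R" "j \<notin> R" "l \<notin> R" "j \<noteq> l"
  shows "zeta (\<lambda>A. f (transvection j l A) + f A) (insert l R)
       = zeta f (insert j R) + zeta f (insert j (insert l R))"
proof -
  have 1: "zeta (\<lambda>A. f (transvection j l A) + f A) R = 0"
  proof -
    have "zeta (\<lambda>A. f (transvection j l A) + f A) R = zeta (\<lambda>A. 0) R"
      by (rule zeta_cong) (use assms in \<open>auto simp: transvection_def\<close>)
    then show ?thesis
      by (simp add: zeta_def)
  qed
  have 2: "zeta (\<lambda>A. f (transvection j l (insert l A)) + f (insert l A)) R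
    = zeta (\<lambda>A. f (insert j (insert l A)) + f (insert l A)) R"
  proof (rule zeta_cong)
    fix A assume "A \<subseteq> R"
    then have "transvection j l (insert l A) = insert j (insert l A)"
      using assms by (auto simp: transvection_def)
    then show "f (transvection j l (insert l A)) + f (insert l A)
        = f (insert j (insert l A)) + f (insert l A)"
      by simp
  qed
  have 3: "zeta f (insert j (insert l R))
    = zeta f (insert j R) + zeta (\<lambda>A. f (insert l A) + f (insert j (insert l A))) R"
  proof -
    have "zeta f (insert j (insert l R)) = zeta f (insert l (insert j R))"
      by (simp add: insert_commute)
    also have "\<dots> = zeta f (insert j R) + zeta (\<lambda>A. f (insert l A)) (insert j R)"
      using assms by (intro zeta_insert) auto
    also have "zeta (\<lambda>A. f (insert l A)) (insert j R)
        = zeta (\<lambda>A. f (insert l A)) R + zeta (\<lambda>A. f (insert l (insert j A))) R"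
      using assms by (intro zeta_insert) auto
    finally show ?thesis
      by (simp add: zeta_add insert_commute)
  qed
  show ?thesis
    unfolding zeta_insert[OF assms(1,3)] 1 2 3 by (simp add: add.commute)
qed

text \<open>
  Take a monomial \<open>S\<close> of largest index sum among those violating the bound. If \<open>j\<close> is in \<open>S\<close> but
  its predecessor \<open>j - 1\<close>, still positive, is not, then the difference along
  \<open>x_j \<mapsto> x_j + x_{j-1}\<close> contains the monomial with \<open>j\<close> replaced by \<open>j - 1\<close>: the only other
  source of that monomial is \<open>S \<union> {j - 1}\<close>, which maximality excludes. The new monomial is
  lighter by just one unit, which is impossible. If there is no such \<open>j\<close>, then \<open>S = {1..r}\<close>, and
  the difference along \<open>x_1 \<mapsto> x_1 + 1\<close> contains \<open>{2..r}\<close>, which leaves only \<open>S = {1, 2}\<close>; but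
  its sum 3 does not violate the bound.
\<close>

lemma monomial_bound_from_differences:
  assumes f: "f \<in> polys N (Pow {1..<N})" and c: "2 \<le> c"
    and flip: "(\<lambda>A. f (sym_diff A {1}) + f A) \<in> polys N (adm N c N)"
    and tv: "\<And>j. j \<in> {2..<N} \<Longrightarrow> (\<lambda>A. f (transvection j (j - 1) A) + f A) \<in> polys N (adm N c N)"
  shows "f \<in> polys N (adm N (Suc c) N)"
proof (rule ccontr)
  define X where "X = {S. S \<subseteq> {1..N} \<and> zeta f S \<noteq> 0 \<and> S \<notin> adm N (Suc c) N}"
  assume "f \<notin> polys N (adm N (Suc c) N)"
  then have "X \<noteq> {}"
    by (auto simp: X_def polys_def)
  moreover have fin: "finite X"
    by (rule finite_subset[of _ "Pow {1..N}"]) (auto simp: X_def)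
  ultimately have "Max (Sum ` X) \<in> Sum ` X"
    by (intro Max_in) auto
  then obtain S where S: "S \<in> X" "\<Sum>S = Max (Sum ` X)"
    by (metis imageE)
  have max: "\<Sum>S' \<le> \<Sum>S" if "S' \<in> X" for S'
    unfolding S(2) using that fin by (intro Max_ge) auto
  have SN: "S \<subseteq> {1..<N}"
    using S polysD[OF f] by (auto simp: X_def)
  then have fin: "finite S"
    by (rule finite_subset) auto
  have S2: "2 \<le> card S" "c + 2 \<le> \<Sum>S"
    using S SN by (auto simp: X_def adm_def)
  have zS: "zeta f S = 1"
    using S by (simp add: X_def)
  show False
  proof (cases "\<exists>j\<in>S. 2 \<le> j \<and> j - 1 \<notin> S")
    case True
    then obtain j where j: "j \<in> S" "2 \<le> j" "j - 1 \<notin> S"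
      by auto
    define R where "R = S - {j}"
    have R: "S = insert j R" "j \<notin> R" "j - 1 \<notin> R" "finite R" "j \<noteq> j - 1"
      using j fin by (auto simp: R_def)
    have sub: "j - 1 \<in> {1..<N}" "j \<in> {2..<N}" "insert (j - 1) R \<subseteq> {1..<N}" "insert (j - 1) R \<subseteq> {1..N}"
      "insert j (insert (j - 1) R) \<subseteq> {1..N}"
      using SN j by (auto simp: R_def)
    have cardR: "card S = Suc (card R)" "card (insert (j - 1) R) = card S"
      "card (insert j (insert (j - 1) R)) = Suc (card S)"
      using R by auto
    have sumR: "\<Sum>S = j + \<Sum>R" "\<Sum>(insert (j - 1) R) = (j - 1) + \<Sum>R"
      "\<Sum>(insert j (insert (j - 1) R)) = j + ((j - 1) + \<Sum>R)"
      using R by auto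
    \<comment> \<open>The other contribution to the coefficient of the lowered monomial vanishes by maximality.\<close>
    have "insert j (insert (j - 1) R) \<notin> X"
      using max[of "insert j (insert (j - 1) R)"] sumR j by auto
    moreover have "insert j (insert (j - 1) R) \<notin> adm N (Suc c) N"
      using sumR cardR S2 j by (auto simp: adm_def)
    ultimately have "zeta f (insert j (insert (j - 1) R)) = 0"
      using sub by (auto simp: X_def)
    then have "zeta (\<lambda>A. f (transvection j (j - 1) A) + f A) (insert (j - 1) R) = 1"
      using zeta_transvection_diff[of R j "j - 1" f] R zS by simp
    then have "insert (j - 1) R \<in> adm N c N"
      using polysD[OF tv[OF sub(2)] sub(4)] by simp
    then show False
      using sumR cardR S2 by (auto simp: adm_def)
  next
    case False
    have "S \<noteq> {}"
      using S2 by auto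
    then have least: "Min S \<in> S"
      using fin by simp
    have "1 \<in> S"
    proof (cases "2 \<le> Min S")
      case True
      then have "Min S - 1 \<in> S"
        using False least by auto
      then have "Min S \<le> Min S - 1"
        using fin by (rule Min_le[rotated])
      then show ?thesis
        using True by simp
    next
      case F: False
      have "1 \<le> Min S"
        using least SN by auto
      then show ?thesis
        using F least by (simp add: le_antisym not_less_eq_eq numeral_2_eq_2)
    qed
    define R where "R = S - {1}"
    have R: "S = insert 1 R" "1 \<notin> R" "finite R" "R \<subseteq> {1..N}"
      using \<open>1 \<in> S\<close> fin SN by (auto simp: R_def)
    have "zeta (\<lambda>A. f (sym_diff A {1}) + f A) R = 1"
      using zeta_translation_diff[of R 1 f] R zS by simp
    then have "R \<in> adm N c N"
      using polysD[OF flip R(4)] by simp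
    then have "card R \<le> 1"
      using R S2 by (auto simp: adm_def)
    then have "card R = 1"
      using R S2 by auto
    then obtain a where a: "R = {a}"
      by (meson card_1_singletonE)
    then have "a \<in> S" "a \<noteq> 1" "1 \<le> a"
      using R SN by auto
    then have "a - 1 \<in> S"
      using False by auto
    then have "a - 1 = 1"
      using R a \<open>a \<noteq> 1\<close> by auto
    then have "\<Sum>S = 3"
      using R a by simp
    then show False
      using S2 c by simp
  qed
qed

text \<open>
  The descent of \<open>chain (Suc n) 2\<close> is \<open>chain n 1\<close>, which is again the affine group in one
  coordinate less, so the descended map is only known to normalize that group. To see that it
  belongs to it, use that \<open>g\<close> conjugates a map \<open>h\<close> of the chain to the transvection adding \<open>x_i\<close>
  to the last coordinate. This \<open>h\<close> can change the last coordinate only, and it does so by the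
  \<open>i\<close>-th coordinate of \<open>g\<close>, which is therefore affine.
\<close>

lemma normalizer_shift_degree_le_1:
  assumes g: "normalizes (Suc n) (chain (Suc n) 2) g" and i: "i \<in> {1..n}"
  shows "shift g i \<in> polys (Suc n) {S. S \<subseteq> {1..<i} \<and> card S \<le> 1}"
proof -
  let ?N = "Suc n"
  have "transvection ?N i \<in> chain ?N 2"
    using i by (intro transvection_in_chain) auto
  with g obtain h where h: "h \<in> chain ?N 2"
    "\<And>A. A \<subseteq> {1..?N} \<Longrightarrow> g (h A) = transvection ?N i (g A)"
    by (rule normalizes_bwd) (rule that)
  have g': "normalizes n (chain n (2 - 1)) (\<lambda>A. g A \<inter> {1..n})"
    using g by (rule normalizer_descends)
  have *: "coord i (g A) = shift h ?N A" if A: "A \<subseteq> {1..?N}" for A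
  proof -
    note hA = chain_maps[OF h(1) A]
    have "g (h A \<inter> {1..n}) \<inter> {1..n} = g (h A) \<inter> {1..n}"
      using normalizer_descends_eq[OF g hA] by simp
    also have "\<dots> = g A \<inter> {1..n}"
      unfolding h(2)[OF A] by (auto simp: transvection_def)
    also have "\<dots> = g (A \<inter> {1..n}) \<inter> {1..n}"
      by (rule normalizer_descends_eq[OF g A])
    finally have eq: "h A \<inter> {1..n} = A \<inter> {1..n}"
      by (rule normalizes_inj[OF g' _ Int_lower2 Int_lower2])
    have "shift h ?N A = coord i (g A)"
    proof (cases "?N \<in> h A \<longleftrightarrow> ?N \<in> A")
      case True
      then have "h A = A"
        using equal_or_top_flip[OF hA A eq] by auto
      then have "transvection ?N i (g A) = g A"
        using h(2)[OF A] by simp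
      then have "i \<notin> g A"
        by (auto simp: transvection_def split: if_splits)
      then show ?thesis
        using True by (simp add: shift_def coord_def)
    next
      case False
      have "i \<in> g A"
      proof (rule ccontr)
        assume "i \<notin> g A"
        then have "g (h A) = g A"
          using h(2)[OF A] by (simp add: transvection_def)
        then have "h A = A"
          by (rule normalizes_inj[OF g _ hA A])
        then show False
          using False by simp
      qed
      then show ?thesis
        using False by (simp add: shift_def coord_def)
    qed
    then show ?thesis by simp
  qed
  have "shift h ?N \<in> polys ?N {S. card S \<le> 1}"
    using chain_shift[OF h(1), of ?N] by (rule_tac polys_mono) (auto simp: adm_2)
  moreover have "coord i \<in> polys ?N {S. card S \<le> 1}"
    using polys_monomial[of "{i}" "{S. card S \<le> 1}" ?N] by (simp add: coord_def[abs_def])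
  ultimately have "(\<lambda>A. shift h ?N A + coord i A) \<in> polys ?N {S. card S \<le> 1}"
    by (rule polys_add)
  then have "shift g i \<in> polys ?N {S. card S \<le> 1}"
    by (rule polys_cong[THEN iffD1, rotated]) (simp add: shift_def[of g] *)
  moreover have "shift g i \<in> polys ?N (Pow {1..<i})"
    using i by (intro normalizer_triangular[OF g]) auto
  ultimately have "shift g i \<in> polys ?N ({S. card S \<le> 1} \<inter> Pow {1..<i})"
    by (rule polys_Int)
  then show ?thesis
    by (rule polys_mono) auto
qed

text \<open>
  If \<open>g\<close> conjugates \<open>h\<close> to \<open>m\<close>, comparing the last coordinates of \<open>g (h A)\<close> and \<open>m (g A)\<close>
  expresses the difference of the last shift of \<open>g\<close> along \<open>h\<close> by the last shift of \<open>m\<close>, composed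
  with \<open>g\<close>. The lower shifts of \<open>g\<close> being under control, this composition stays within the bound
  for \<open>c\<close>.
\<close>

lemma normalizer_top_shift_differences:
  assumes g: "normalizes (Suc n) (chain (Suc n) c) g" and c: "c \<le> n"
    and low: "\<And>i. i \<in> {1..n} \<Longrightarrow> shift g i \<in> polys (Suc n) (adm (Suc n) (Suc c) i)"
    and h: "h \<in> chain (Suc n) c" "\<And>A. Suc n \<in> h A \<longleftrightarrow> Suc n \<in> A"
  shows "(\<lambda>A. shift g (Suc n) (h A) + shift g (Suc n) A) \<in> polys (Suc n) (adm (Suc n) c (Suc n))"
proof -
  let ?N = "Suc n"
  obtain m where m: "m \<in> chain ?N c" "\<And>A. A \<subseteq> {1..?N} \<Longrightarrow> g (h A) = m (g A)"
    using g h(1) by (rule normalizes_fwd) (rule that)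
  have "(\<lambda>A. shift m ?N (g A)) \<in> polys ?N (adm ?N c ?N)"
  proof (rule polys_adm_compose[where d = "Suc c"])
    show "shift m ?N \<in> polys ?N (adm ?N c ?N)"
      by (rule chain_shift[OF m(1)]) auto
  qed (use c low normalizes_maps[OF g] in auto)
  moreover have "shift m ?N (g A) = shift g ?N (h A) + shift g ?N A" if "A \<subseteq> {1..?N}" for A
  proof -
    have "coord ?N (h A) = coord ?N A"
      using h(2) by (simp add: coord_def)
    then show ?thesis
      using m(2)[OF that] by (simp add: shift_def ac_simps)
  qed
  ultimately show ?thesis
    by (rule polys_cong[THEN iffD1, rotated])
qed

text \<open>
  The inclusion of the normalizer in the next member of the chain. The shifts below the last one
  are bounded by the induction hypothesis for the descended map, except for \<open>c = 2\<close>, where the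
  descended group has the parameter 1; the last shift is bounded through its differences.
\<close>

lemma normalizer_in_chain:
  assumes "2 \<le> c" "c < n" "normalizes n (chain n c) g"
  shows "g \<in> chain n (Suc c)"
  using assms
proof (induction n arbitrary: c g)
  case (Suc n)
  let ?N = "Suc n"
  note g = Suc.prems(3)
  have low: "shift g i \<in> polys ?N (adm ?N (Suc c) i)" if i: "i \<in> {1..n}" for i
  proof (cases "c = 2")
    case True
    show ?thesis
      using normalizer_shift_degree_le_1[OF g[unfolded True] i]
      by (rule polys_mono) (auto simp: adm_def)
  next
    case False
    have "(\<lambda>A. g A \<inter> {1..n}) \<in> chain n (Suc (c - 1))"
      by (rule Suc.IH[OF _ _ normalizer_descends[OF g]]) (use False Suc.prems in auto)
    then have "shift (\<lambda>A. g A \<inter> {1..n}) i \<in> polys n (adm n c i)"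
      using chain_shift[OF _ i] Suc.prems by fastforce
    then have "shift g i \<in> polys ?N (adm n c i)"
      by (rule shift_lifts_polys[OF g i]) (rule adm_subset_Pow[OF i])
    then show ?thesis
      using i adm_Suc[of i n "Suc c"] by simp
  qed
  have diffs: "(\<lambda>A. shift g ?N (h A) + shift g ?N A) \<in> polys ?N (adm ?N c ?N)"
    if "h \<in> chain ?N c" "\<And>A. ?N \<in> h A \<longleftrightarrow> ?N \<in> A" for h
    using normalizer_top_shift_differences[OF g _ low that] Suc.prems by simp
  have top: "shift g ?N \<in> polys ?N (adm ?N (Suc c) ?N)"
  proof (rule monomial_bound_from_differences)
    show "shift g ?N \<in> polys ?N (Pow {1..<?N})"
      by (rule normalizer_triangular[OF g]) auto
    show "(\<lambda>A. shift g ?N (sym_diff A {1}) + shift g ?N A) \<in> polys ?N (adm ?N c ?N)"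
      using Suc.prems by (intro diffs translation_in_chain) auto
    show "(\<lambda>A. shift g ?N (transvection j (j - 1) A) + shift g ?N A) \<in> polys ?N (adm ?N c ?N)"
      if "j \<in> {2..<?N}" for j
      using that by (intro diffs transvection_in_chain) (auto simp: transvection_def)
  qed (use Suc.prems in auto)
  show ?case
  proof (rule chainI)
    fix i assume "i \<in> {1..?N}"
    then show "shift g i \<in> polys ?N (adm ?N (Suc c) i)"
      using low top by (cases "i = ?N") auto
  qed (rule normalizes_maps[OF g])
qed simp

section \<open>Points as subsets, and the action of the generators\<close>

text \<open>
  The digits are reversed, the element \<open>i\<close> standing for the binary digit of weight
  \<open>2 ^ (n - i)\<close>. The generator \<open>s_gen k\<close> changes one digit under a condition on the more
  significant ones, so with this numbering each coordinate is modified by a function of the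
  preceding ones.
\<close>

definition enc :: "nat \<Rightarrow> nat set \<Rightarrow> nat" where
  "enc n A = Suc (set_encode ((\<lambda>i. n - i) ` A))"

definition dec :: "nat \<Rightarrow> nat \<Rightarrow> nat set" where
  "dec n x = {i \<in> {1..n}. n - i \<in> set_decode (x - 1)}"

lemma set_encode_less:
  assumes "B \<subseteq> {..<n}"
  shows "set_encode B < 2 ^ n"
proof -
  have "set_encode B \<le> (\<Sum>i<n. 2 ^ i)"
    unfolding set_encode_def using assms by (intro sum_mono2) auto
  also have "\<dots> < 2 ^ n"
    by (induction n) auto
  finally show ?thesis .
qed

lemma set_decode_less:
  assumes "x < 2 ^ n"
  shows "set_decode x \<subseteq> {..<n}"
proof
  fix i assume "i \<in> set_decode x"
  then have "x div 2 ^ i \<noteq> 0"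
    by (auto simp: set_decode_def intro: ccontr)
  then have "2 ^ i \<le> x"
    by (simp add: div_eq_0_iff)
  then have "(2::nat) ^ i < 2 ^ n"
    using assms by linarith
  then show "i \<in> {..<n}"
    by simp
qed

lemma enc_in:
  assumes "A \<subseteq> {1..n}"
  shows "enc n A \<in> {1..2 ^ n}"
proof -
  have "(\<lambda>i. n - i) ` A \<subseteq> {..<n}"
    using assms by force
  then show ?thesis
    using set_encode_less[of "(\<lambda>i. n - i) ` A" n] by (simp add: enc_def Suc_le_eq)
qed

lemma dec_subset: "dec n x \<subseteq> {1..n}"
  by (auto simp: dec_def)

lemma dec_enc:
  assumes A: "A \<subseteq> {1..n}"
  shows "dec n (enc n A) = A"
proof -
  have "n - i \<in> (\<lambda>i. n - i) ` A \<longleftrightarrow> i \<in> A" if i: "i \<in> {1..n}" for i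
  proof
    assume "n - i \<in> (\<lambda>i. n - i) ` A"
    then obtain j where j: "j \<in> A" "n - i = n - j"
      by auto
    then have "i = j"
      using i subsetD[OF A j(1)] by auto
    then show "i \<in> A"
      using j by simp
  qed auto
  moreover have "finite A"
    using A by (rule finite_subset) auto
  ultimately show ?thesis
    using A by (auto simp: dec_def enc_def)
qed

lemma enc_dec:
  assumes "x \<in> {1..2 ^ n}"
  shows "enc n (dec n x) = x"
proof -
  have "set_decode (x - 1) \<subseteq> {..<n}"
    using assms by (intro set_decode_less) auto
  then have "(\<lambda>i. n - i) ` dec n x = set_decode (x - 1)"
  proof (intro equalityI subsetI)
    fix k assume sub: "set_decode (x - 1) \<subseteq> {..<n}" and k: "k \<in> set_decode (x - 1)"
    then have "k < n"
      by auto
    then have "n - k \<in> dec n x" "k = n - (n - k)"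
      using k by (auto simp: dec_def)
    then show "k \<in> (\<lambda>i. n - i) ` dec n x"
      by (metis imageI)
  qed (auto simp: dec_def)
  then show ?thesis
    using assms by (simp add: enc_def)
qed

lemma enc_inj: "A \<subseteq> {1..n} \<Longrightarrow> B \<subseteq> {1..n} \<Longrightarrow> enc n A = enc n B \<Longrightarrow> A = B"
  by (metis dec_enc)

lemma dec_inj: "x \<in> {1..2 ^ n} \<Longrightarrow> y \<in> {1..2 ^ n} \<Longrightarrow> dec n x = dec n y \<Longrightarrow> x = y"
  by (metis enc_dec)

definition act :: "nat \<Rightarrow> (nat \<Rightarrow> nat) \<Rightarrow> nat set \<Rightarrow> nat set" where
  "act n p A = dec n (p (enc n A))"

definition perm_of :: "nat \<Rightarrow> (nat set \<Rightarrow> nat set) \<Rightarrow> nat \<Rightarrow> nat" where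
  "perm_of n g x = (if x \<in> {1..2 ^ n} then enc n (g (dec n x)) else x)"

lemma act_subset: "act n p A \<subseteq> {1..n}"
  unfolding act_def by (rule dec_subset)

lemma permutes_enc:
  assumes "p permutes {1..2 ^ n}" "A \<subseteq> {1..n}"
  shows "p (enc n A) \<in> {1..2 ^ n}"
  unfolding permutes_in_image[OF assms(1)] by (rule enc_in[OF assms(2)])

lemma enc_act:
  assumes "p permutes {1..2 ^ n}" "A \<subseteq> {1..n}"
  shows "enc n (act n p A) = p (enc n A)"
  unfolding act_def by (rule enc_dec[OF permutes_enc[OF assms]])

lemma act_comp:
  assumes "q permutes {1..2 ^ n}" "A \<subseteq> {1..n}"
  shows "act n (p \<circ> q) A = act n p (act n q A)"
  using enc_act[OF assms] by (simp add: act_def[of n p] act_def[of n "p \<circ> q"])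

lemma act_id: "A \<subseteq> {1..n} \<Longrightarrow> act n id A = A"
  by (simp add: act_def dec_enc)

lemma act_bij:
  assumes p: "p permutes {1..2 ^ n}"
  shows "bij_betw (act n p) (Pow {1..n}) (Pow {1..n})"
proof -
  have "inj_on (act n p) (Pow {1..n})"
  proof (rule inj_onI)
    fix A B assume A: "A \<in> Pow {1..n}" and B: "B \<in> Pow {1..n}" and eq: "act n p A = act n p B"
    have "p (enc n A) = p (enc n B)"
      using dec_inj[OF permutes_enc[OF p] permutes_enc[OF p], of A B] eq A B
      by (simp add: act_def)
    then have "enc n A = enc n B"
      using permutes_inj[OF p] by (simp add: inj_eq)
    then show "A = B"
      using enc_inj A B by simp
  qed
  moreover have "act n p ` Pow {1..n} \<subseteq> Pow {1..n}"
    by (intro image_subsetI PowI act_subset)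
  ultimately show ?thesis
    unfolding bij_betw_def by (intro conjI endo_inj_surj) auto
qed

lemma perm_eqI:
  assumes "p permutes {1..2 ^ n}" "q permutes {1..2 ^ n}" "\<And>A. A \<subseteq> {1..n} \<Longrightarrow> act n p A = act n q A"
  shows "p = q"
proof
  fix x
  show "p x = q x"
  proof (cases "x \<in> {1..2 ^ n}")
    case True
    have "p (enc n (dec n x)) = q (enc n (dec n x))"
      using enc_act[OF assms(1) dec_subset] enc_act[OF assms(2) dec_subset] assms(3)[OF dec_subset]
      by metis
    then show ?thesis
      using enc_dec[OF True] by simp
  next
    case False
    then show ?thesis
      using permutes_not_in[OF assms(1)] permutes_not_in[OF assms(2)] by metis
  qed
qed

lemma
  assumes g: "bij_betw g (Pow {1..n}) (Pow {1..n})"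
  shows perm_of_permutes: "perm_of n g permutes {1..2 ^ n}"
    and act_perm_of: "A \<subseteq> {1..n} \<Longrightarrow> act n (perm_of n g) A = g A"
proof -
  have gsub: "g A \<subseteq> {1..n}" if "A \<subseteq> {1..n}" for A
    using bij_betwE[OF g] that by auto
  have "inj_on (perm_of n g) {1..2 ^ n}"
  proof (rule inj_onI)
    fix x y assume x: "x \<in> {1..2 ^ n}" and y: "y \<in> {1..2 ^ n}" and eq: "perm_of n g x = perm_of n g y"
    have "enc n (g (dec n x)) = enc n (g (dec n y))"
      using eq x y by (simp only: perm_of_def if_True)
    then have "g (dec n x) = g (dec n y)"
      by (rule enc_inj[OF gsub[OF dec_subset] gsub[OF dec_subset]])
    then have "dec n x = dec n y"
      by (rule inj_onD[OF bij_betw_imp_inj_on[OF g]]) (intro PowI dec_subset)+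
    then show "x = y"
      by (rule dec_inj[OF x y])
  qed
  moreover have "perm_of n g ` {1..2 ^ n} \<subseteq> {1..2 ^ n}"
  proof (rule image_subsetI)
    fix x :: nat assume "x \<in> {1..2 ^ n}"
    then show "perm_of n g x \<in> {1..2 ^ n}"
      using enc_in[OF gsub[OF dec_subset]] by (simp only: perm_of_def if_True)
  qed
  ultimately have "bij_betw (perm_of n g) {1..2 ^ n} {1..2 ^ n}"
    unfolding bij_betw_def by (intro conjI endo_inj_surj) auto
  then show "perm_of n g permutes {1..2 ^ n}"
    by (rule bij_imp_permutes) (simp only: perm_of_def if_False)
  show "act n (perm_of n g) A = g A" if A: "A \<subseteq> {1..n}" for A
  proof -
    have "perm_of n g (enc n A) = enc n (g A)"
      using enc_in[OF A] dec_enc[OF A] by (simp only: perm_of_def if_True)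
    then show ?thesis
      using dec_enc[OF gsub[OF A]] by (simp add: act_def)
  qed
qed

lemma foldr_comp_append: "foldr (\<circ>) (xs @ [f]) id = foldr (\<circ>) xs id \<circ> f"
  by (induction xs) auto

text \<open>
  The induction runs over the partial products of the first \<open>k\<close> transpositions.
\<close>

lemma s_gen_apply:
  "s_gen i x = (if x \<in> {1..2 ^ (i - 1)} then x + 2 ^ (i - 1)
                else if x \<in> {2 ^ (i - 1) + 1..2 * 2 ^ (i - 1)} then x - 2 ^ (i - 1) else x)"
proof -
  define m :: nat where "m = 2 ^ (i - 1)"
  define F where "F k = foldr (\<circ>) (map (\<lambda>j. Transposition.transpose j (j + m)) [1..<Suc k]) id" for k
  have F_Suc: "F (Suc k) x = F k (Transposition.transpose (Suc k) (Suc k + m) x)" for k x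
    unfolding F_def
    using foldr_comp_append[of "map (\<lambda>j. Transposition.transpose j (j + m)) [1..<Suc k]"]
    by (simp only: upt_Suc_append[of 1 "Suc k"] map_append list.map comp_apply)
  have "F k x = (if 1 \<le> x \<and> x \<le> k then x + m else if m + 1 \<le> x \<and> x \<le> m + k then x - m else x)"
    if "k \<le> m" for k
    using that
  proof (induction k arbitrary: x)
    case 0
    show ?case
      by (simp add: F_def)
  next
    case (Suc k)
    consider "x = Suc k" | "x = Suc k + m" | "x \<noteq> Suc k" "x \<noteq> Suc k + m"
      by blast
    then show ?case
    proof cases
      case 1
      then have "F (Suc k) x = F k (Suc k + m)"
        by (simp add: F_Suc)
      also have "\<dots> = Suc k + m"
        using Suc.IH[of "Suc k + m"] Suc.prems by simp
      finally show ?thesis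
        using 1 by simp
    next
      case 2
      then have "F (Suc k) x = F k (Suc k)"
        by (simp add: F_Suc)
      also have "\<dots> = Suc k"
        using Suc.IH[of "Suc k"] Suc.prems by simp
      finally show ?thesis
        using 2 Suc.prems by simp
    next
      case 3
      then have "F (Suc k) x = F k x"
        by (simp add: F_Suc)
      also have "\<dots> = (if 1 \<le> x \<and> x \<le> k then x + m
          else if m + 1 \<le> x \<and> x \<le> m + k then x - m else x)"
        using Suc.IH[of x] Suc.prems by simp
      finally show ?thesis
        using 3 by (simp add: le_Suc_eq)
    qed
  qed
  from this[of m] show ?thesis
    unfolding s_gen_def m_def[symmetric] F_def by (simp add: mult_2)
qed

text \<open>
  The same encoding with digits numbered from the least significant one. It does not depend on
  \<open>n\<close>, as is needed for the recursion that defines \<open>t_gen\<close>.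
\<close>

definition pt :: "nat set \<Rightarrow> nat" where
  "pt B = Suc (set_encode B)"

lemma pt_cases:
  obtains "x = 0" | B where "finite B" "x = pt B"
proof (cases x)
  case (Suc y)
  then have "x = pt (set_decode y)"
    by (simp add: pt_def)
  then show ?thesis
    using that(2)[of "set_decode y"] by simp
qed (use that in auto)

lemma pt_le_iff:
  assumes "finite B"
  shows "pt B \<le> 2 ^ k \<longleftrightarrow> B \<subseteq> {..<k}"
  using set_encode_less[of B k] set_decode_less[of "set_encode B" k] assms
  by (auto simp: pt_def Suc_le_eq)

lemma pt_insert: "finite B \<Longrightarrow> i \<notin> B \<Longrightarrow> pt (insert i B) = pt B + 2 ^ i"
  by (simp add: pt_def)

lemma s_gen_pt:
  assumes B: "finite B"
  shows "s_gen (Suc k) (pt B) = (if B \<subseteq> {..k} then pt (sym_diff B {k}) else pt B)"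
proof -
  have pos: "1 \<le> pt B"
    by (simp add: pt_def)
  consider "B \<subseteq> {..<k}" | "k \<in> B" "B \<subseteq> {..k}" | "\<not> B \<subseteq> {..k}"
    by (metis atMost_iff lessThan_iff nat_less_le subset_iff)
  then show ?thesis
  proof cases
    case 1
    then have "sym_diff B {k} = insert k B" "k \<notin> B"
      by auto
    moreover have "pt B \<le> 2 ^ k"
      using 1 pt_le_iff[OF B] by simp
    moreover have "B \<subseteq> {..k}"
      using 1 by auto
    ultimately show ?thesis
      using pos B by (simp add: s_gen_apply pt_insert)
  next
    case 2
    then have C: "sym_diff B {k} = B - {k}" "insert k (B - {k}) = B"
      by auto
    have "B - {k} \<subseteq> {..<k}"
      using 2 by (auto simp: less_le)
    then have "pt (B - {k}) \<le> 2 ^ k" "1 \<le> pt (B - {k})"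
      using pt_le_iff[of "B - {k}" k] B by (simp_all add: pt_def)
    moreover have "pt B = pt (B - {k}) + 2 ^ k"
      using pt_insert[of "B - {k}" k] B C by simp
    ultimately show ?thesis
      using 2 C by (simp add: s_gen_apply)
  next
    case 3
    then have "\<not> B \<subseteq> {..<Suc k}"
      by (simp add: lessThan_Suc_atMost)
    then have "\<not> pt B \<le> 2 ^ Suc k"
      using pt_le_iff[OF B, of "Suc k"] by blast
    then show ?thesis
      using 3 by (simp add: s_gen_apply)
  qed
qed

lemma s_gen_0: "s_gen k 0 = 0"
  by (simp add: s_gen_apply)

lemma s_gen_involution: "s_gen (Suc k) \<circ> s_gen (Suc k) = id"
proof
  fix x
  show "(s_gen (Suc k) \<circ> s_gen (Suc k)) x = id x"
  proof (cases x rule: pt_cases)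
    case (2 B)
    have "sym_diff (sym_diff B {k}) {k} = B"
      by auto
    then show ?thesis
      using 2 by (auto simp: s_gen_pt)
  qed (simp add: s_gen_0)
qed

lemma inv_involution:
  assumes "f \<circ> f = id"
  shows "inv' f = f"
  by (rule inv_equality) (use assms in \<open>simp_all add: fun_eq_iff\<close>)

text \<open>
  Conjugation by \<open>s_gen (Suc n)\<close> moves \<open>t_gen n\<close> from the lower to the upper half of the points,
  so the product of \<open>t_gen n\<close> and its conjugate flips the digit on both halves.
\<close>

lemma t_gen_pt:
  assumes "finite B" "k < n"
  shows "t_gen n (Suc k) (pt B) = (if B \<subseteq> {..<n} then pt (sym_diff B {k}) else pt B)"
  using assms
proof (induction n arbitrary: B)
  case (Suc n)
  let ?s = "s_gen (Suc n)" and ?t = "t_gen n (Suc k)"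
  show ?case
  proof (cases "k = n")
    case True
    then show ?thesis
      using Suc.prems by (simp add: s_gen_pt lessThan_Suc_atMost)
  next
    case False
    then have k: "k < n"
      using Suc.prems by simp
    have t: "t_gen (Suc n) (Suc k) (pt B) = ?t (?s (?t (?s (pt B))))"
      using False by (simp add: perm_conj_def inv_involution[OF s_gen_involution])
    note IH = Suc.IH[OF _ k]
    have fin: "finite B"
      by (rule Suc.prems)
    consider "B \<subseteq> {..<n}" | "n \<in> B" "B \<subseteq> {..n}" | "\<not> B \<subseteq> {..n}"
      by (metis atMost_iff lessThan_iff nat_less_le subset_iff)
    then show ?thesis
    proof cases
      case 1
      then have e: "sym_diff B {n} = insert n B" "B \<subseteq> {..n}" "n \<notin> B" "\<not> insert n B \<subseteq> {..<n}"
        "insert n B \<subseteq> {..n}" "sym_diff (insert n B) {n} = B" "B \<subseteq> {..<Suc n}"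
        by auto
      show ?thesis
        unfolding t using e 1 fin by (simp add: s_gen_pt IH)
    next
      case 2
      then have e: "sym_diff B {n} = B - {n}" "B - {n} \<subseteq> {..<n}"
        "sym_diff (B - {n}) {k} \<subseteq> {..n}" "sym_diff (sym_diff (B - {n}) {k}) {n} = sym_diff B {k}"
        "\<not> sym_diff B {k} \<subseteq> {..<n}" "B \<subseteq> {..<Suc n}"
        using k by (auto simp: less_le)
      have "?s (pt B) = pt (B - {n})"
        using 2 fin e by (simp add: s_gen_pt)
      moreover have "?t (pt (B - {n})) = pt (sym_diff (B - {n}) {k})"
        using fin e by (simp add: IH)
      moreover have "?s (pt (sym_diff (B - {n}) {k})) = pt (sym_diff B {k})"
        using fin e by (simp only: s_gen_pt finite_Diff finite_Un finite.intros if_True)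
      moreover have "?t (pt (sym_diff B {k})) = pt (sym_diff B {k})"
        using fin e by (simp only: IH finite_Diff finite_Un finite.intros if_False)
      ultimately show ?thesis
        unfolding t using e by simp
    next
      case 3
      then have "\<not> B \<subseteq> {..<n}" "\<not> B \<subseteq> {..<Suc n}"
        by auto
      then show ?thesis
        unfolding t using 3 fin by (simp add: s_gen_pt IH)
    qed
  qed
qed simp

lemma t_gen_0: "t_gen n (Suc k) 0 = 0"
proof (induction n)
  case (Suc n)
  then show ?case
    by (simp add: perm_conj_def inv_involution[OF s_gen_involution] s_gen_0)
qed simp

lemma enc_pt: "enc n A = pt ((\<lambda>i. n - i) ` A)"
  by (simp add: enc_def pt_def)

lemma rev_sym_diff:
  fixes A :: "nat set"
  assumes "A \<subseteq> {1..n}" "i \<in> {1..n}"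
  shows "sym_diff ((\<lambda>j. n - j) ` A) {n - i} = (\<lambda>j. n - j) ` sym_diff A {i}"
proof -
  have "n - j = n - i \<longleftrightarrow> j = i" "n - i = n - j \<longleftrightarrow> i = j" if "j \<in> A" for j
    using assms(2) subsetD[OF assms(1) that] by auto
  then show ?thesis
    by auto
qed

lemma involution_permutes:
  assumes "f \<circ> f = id" "\<And>x. x \<notin> S \<Longrightarrow> f x = x"
  shows "f permutes S"
  unfolding permutes_def
proof (intro conjI allI impI)
  fix y
  show "\<exists>!x. f x = y"
    using assms(1) by (metis comp_apply id_apply)
qed (rule assms(2))

lemma s_gen_permutes:
  assumes "i \<in> {1..n}"
  shows "s_gen i permutes {1..2 ^ n}"
proof (rule involution_permutes)
  show "s_gen i \<circ> s_gen i = id"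
    using s_gen_involution[of "i - 1"] assms by simp
  fix x :: nat assume "x \<notin> {1..2 ^ n}"
  moreover have "2 * (2::nat) ^ (i - 1) \<le> 2 ^ n"
    using assms power_increasing[of i n "2::nat"] by (simp flip: power_Suc)
  ultimately show "s_gen i x = x"
    by (auto simp: s_gen_apply)
qed

text \<open>
  The number \<open>Suc (n - i)\<close> undoes the reversal of the digits.
\<close>

lemma act_s_gen:
  assumes i: "i \<in> {1..n}" and A: "A \<subseteq> {1..n}"
  shows "act n (s_gen (Suc (n - i))) A = (if A \<inter> {1..<i} = {} then sym_diff A {i} else A)"
proof -
  have fin: "finite ((\<lambda>i. n - i) ` A)"
    using A by (auto intro: finite_subset)
  have "(\<lambda>j. n - j) ` A \<subseteq> {..n - i} \<longleftrightarrow> (\<forall>j\<in>A. i \<le> j)"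
  proof -
    have "n - j \<le> n - i \<longleftrightarrow> i \<le> j" if "j \<in> A" for j
      using i subsetD[OF A that] by auto
    then show ?thesis
      by auto
  qed
  also have "\<dots> \<longleftrightarrow> A \<inter> {1..<i} = {}"
  proof -
    have "j \<in> {1..<i} \<longleftrightarrow> \<not> i \<le> j" if "j \<in> A" for j
      using subsetD[OF A that] by auto
    then show ?thesis
      by blast
  qed
  finally have "s_gen (Suc (n - i)) (enc n A)
    = (if A \<inter> {1..<i} = {} then enc n (sym_diff A {i}) else enc n A)"
    unfolding enc_pt s_gen_pt[OF fin] using rev_sym_diff[OF A i] by simp
  moreover have "sym_diff A {i} \<subseteq> {1..n}"
    using A i by auto
  ultimately show ?thesis
    using dec_enc[OF A] dec_enc[of "sym_diff A {i}" n] by (simp add: act_def)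
qed

lemma t_gen_involution:
  assumes "k < n"
  shows "t_gen n (Suc k) \<circ> t_gen n (Suc k) = id"
proof
  fix x
  show "(t_gen n (Suc k) \<circ> t_gen n (Suc k)) x = id x"
  proof (cases x rule: pt_cases)
    case (2 B)
    have "sym_diff (sym_diff B {k}) {k} = B" "sym_diff B {k} \<subseteq> {..<n} \<longleftrightarrow> B \<subseteq> {..<n}"
      using assms by auto
    then show ?thesis
      using 2 assms by (simp add: t_gen_pt)
  qed (simp add: t_gen_0)
qed

lemma t_gen_permutes:
  assumes "i \<in> {1..n}"
  shows "t_gen n i permutes {1..2 ^ n}"
proof (rule involution_permutes)
  have i: "i - 1 < n" "Suc (i - 1) = i"
    using assms by auto
  show "t_gen n i \<circ> t_gen n i = id"
    using t_gen_involution[of "i - 1" n] i by simp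
  fix x :: nat assume x: "x \<notin> {1..2 ^ n}"
  show "t_gen n i x = x"
  proof (cases x rule: pt_cases)
    case 1
    then show ?thesis
      using t_gen_0[of n "i - 1"] assms by simp
  next
    case (2 B)
    then have "\<not> B \<subseteq> {..<n}"
      using x pt_le_iff[of B n] by (auto simp: pt_def)
    then show ?thesis
      using t_gen_pt[of B "i - 1" n] 2 i by simp
  qed
qed

lemma act_t_gen:
  assumes i: "i \<in> {1..n}" and A: "A \<subseteq> {1..n}"
  shows "act n (t_gen n (Suc (n - i))) A = sym_diff A {i}"
proof -
  have fin: "finite ((\<lambda>i. n - i) ` A)"
    using A by (auto intro: finite_subset)
  have "n - j < n" if "j \<in> A" for j
    using subsetD[OF A that] by auto
  then have "(\<lambda>j. n - j) ` A \<subseteq> {..<n}"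
    by auto
  moreover have "n - i < n"
    using i by auto
  ultimately have "t_gen n (Suc (n - i)) (enc n A) = enc n (sym_diff A {i})"
    unfolding enc_pt using t_gen_pt[OF fin] rev_sym_diff[OF A i] by simp
  moreover have "sym_diff A {i} \<subseteq> {1..n}"
    using A i by auto
  ultimately show ?thesis
    using dec_enc[of "sym_diff A {i}" n] by (simp add: act_def)
qed

section \<open>Normalizers in the symmetric group\<close>

lemma (in group) conjugate_set_eq: "g <# H #> inv g = (\<lambda>h. g \<otimes> h \<otimes> inv g) ` H"
  by (auto simp: l_coset_def r_coset_def)

lemma (in group) conjugation_inj_on:
  assumes "g \<in> carrier G" "H \<subseteq> carrier G"
  shows "inj_on (\<lambda>h. g \<otimes> h \<otimes> inv g) H"
proof (rule inj_onI)
  fix h k assume "h \<in> H" "k \<in> H" and eq: "g \<otimes> h \<otimes> inv g = g \<otimes> k \<otimes> inv g"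
  then have "h \<in> carrier G" "k \<in> carrier G"
    using assms(2) by auto
  then show "h = k"
    using eq assms(1) by simp
qed

lemma (in group) mem_normalizer_iff:
  assumes "H \<subseteq> carrier G"
  shows "g \<in> normalizer G H \<longleftrightarrow> g \<in> carrier G \<and> (\<lambda>h. g \<otimes> h \<otimes> inv g) ` H = H"
  using assms by (auto simp: normalizer_def stabilizer_def conjugate_set_eq)

lemma (in group) mem_normalizer_finite_iff:
  assumes H: "H \<subseteq> carrier G" "finite H"
  shows "g \<in> normalizer G H \<longleftrightarrow> g \<in> carrier G \<and> (\<forall>h\<in>H. g \<otimes> h \<otimes> inv g \<in> H)"
  unfolding mem_normalizer_iff[OF H(1)]
  using endo_inj_surj[OF H(2) _ conjugation_inj_on[OF _ H(1)]] by blast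

lemma (in group) finite_mult_closed_is_subgroup:
  assumes H: "H \<subseteq> carrier G" "finite H" "H \<noteq> {}"
    and closed: "\<And>x y. x \<in> H \<Longrightarrow> y \<in> H \<Longrightarrow> x \<otimes> y \<in> H"
  shows "subgroup H G"
proof (rule subgroupI)
  fix a assume a: "a \<in> H"
  then have ac: "a \<in> carrier G"
    using H by auto
  have "inj_on (\<lambda>x. a \<otimes> x) H"
    using inj_on_multc[OF ac] inj_on_cmult[OF ac] H(1) by (blast intro: inj_on_subset)
  then have surj: "(\<lambda>x. a \<otimes> x) ` H = H"
    using closed[OF a] H(2) by (intro endo_inj_surj) auto
  then obtain e where e: "e \<in> H" "a = a \<otimes> e"
    using a by blast
  then have "e = \<one>"
    using ac H(1) by (metis l_cancel_one' subsetD)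
  then obtain b where b: "b \<in> H" "\<one> = a \<otimes> b"
    using e(1) surj by blast
  then have "inv a = b"
    using ac H(1) by (metis inv_equality inv_inv inv_closed subsetD inv_comm)
  then show "inv a \<in> H"
    using b by simp
qed (use H closed in auto)

lemma finite_sym_group: "finite (carrier (sym_group m))"
  by (simp add: sym_group_def finite_permutations)

text \<open>
  The shifts of a triangular map may have any weight; only the dependence on preceding
  coordinates remains.
\<close>

definition triangular :: "nat \<Rightarrow> (nat set \<Rightarrow> nat set) \<Rightarrow> bool" where
  "triangular n g \<longleftrightarrow> (\<forall>A\<subseteq>{1..n}. g A \<subseteq> {1..n}) \<and> (\<forall>i\<in>{1..n}. shift g i \<in> polys n (Pow {1..<i}))"

lemma triangular_maps: "triangular n g \<Longrightarrow> A \<subseteq> {1..n} \<Longrightarrow> g A \<subseteq> {1..n}"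
  by (simp add: triangular_def)

lemma triangular_restrict:
  assumes "triangular n g" "A \<subseteq> {1..n}" "i \<in> {1..n}"
  shows "shift g i (A \<inter> {1..<i}) = shift g i A"
proof (rule polys_restrict[OF _ assms(2)])
  show "shift g i \<in> polys n (Pow {1..<i})"
    using assms by (simp add: triangular_def)
qed

lemma triangularI:
  assumes "\<And>A. A \<subseteq> {1..n} \<Longrightarrow> g A \<subseteq> {1..n}"
    and "\<And>A i. i \<in> {1..n} \<Longrightarrow> A \<subseteq> {1..n} \<Longrightarrow> shift g i (A \<inter> {1..<i}) = shift g i A"
  shows "triangular n g"
  unfolding triangular_def
proof (intro conjI ballI)
  fix i assume i: "i \<in> {1..n}"
  then have eq: "{1..<i} = {1..i - 1}"
    by auto
  show "shift g i \<in> polys n (Pow {1..<i})"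
    unfolding eq
  proof (rule polys_PowI)
    show "i - 1 \<le> n"
      using i by auto
  qed (rule assms(2)[OF i, unfolded eq])
qed (use assms(1) in blast)

lemma chain_triangular:
  assumes g: "g \<in> chain n c"
  shows "triangular n g"
  unfolding triangular_def
proof (intro conjI ballI)
  show "\<forall>A\<subseteq>{1..n}. g A \<subseteq> {1..n}"
    using chain_maps[OF g] by simp
  show "shift g i \<in> polys n (Pow {1..<i})" if "i \<in> {1..n}" for i
    using chain_shift[OF g that] by (rule polys_mono) (intro PowI adm_subset)
qed

lemma triangular_Int:
  assumes g: "triangular n g" and A: "A \<subseteq> {1..n}" and i: "i \<in> {1..n}"
  shows "g (A \<inter> {1..<i}) \<inter> {1..<i} = g A \<inter> {1..<i}"
proof -
  have "coord j (g (A \<inter> {1..<i})) = coord j (g A)" if j: "j \<in> {1..<i}" for j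
  proof -
    have jn: "j \<in> {1..n}"
      using i j by auto
    have "A \<inter> {1..<i} \<inter> {1..<j} = A \<inter> {1..<j}"
      using j by auto
    then have "shift g j (A \<inter> {1..<i}) = shift g j A"
      using triangular_restrict[OF g A jn] triangular_restrict[OF g _ jn, of "A \<inter> {1..<i}"] A
      by (metis inf.coboundedI1)
    moreover have "coord j (A \<inter> {1..<i}) = coord j A"
      using j by (simp add: coord_def)
    ultimately show ?thesis
      by (simp add: coord_image)
  qed
  then have "j \<in> g (A \<inter> {1..<i}) \<longleftrightarrow> j \<in> g A" if "j \<in> {1..<i}" for j
    using that by (simp add: coord_eq_iff)
  then show ?thesis
    by blast
qed

lemma triangular_comp:
  assumes g: "triangular n g" and h: "triangular n h"
  shows "triangular n (\<lambda>A. g (h A))"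
proof (rule triangularI)
  fix A i assume i: "i \<in> {1..n}" and A: "A \<subseteq> {1..n}"
  have A': "A \<inter> {1..<i} \<subseteq> {1..n}"
    using A by auto
  have "shift g i (h (A \<inter> {1..<i})) = shift g i (h (A \<inter> {1..<i}) \<inter> {1..<i})"
    using triangular_restrict[OF g triangular_maps[OF h A'] i] by simp
  also have "\<dots> = shift g i (h A)"
    unfolding triangular_Int[OF h A i] by (rule triangular_restrict[OF g triangular_maps[OF h A] i])
  finally show "shift (\<lambda>A. g (h A)) i (A \<inter> {1..<i}) = shift (\<lambda>A. g (h A)) i A"
    by (simp only: shift_comp triangular_restrict[OF h A i])
qed (rule triangular_maps[OF g triangular_maps[OF h]])

text \<open>
  The coordinates of a preimage can be recovered one after the other.
\<close>

lemma triangular_bij: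
  assumes g: "triangular n g"
  shows "bij_betw g (Pow {1..n}) (Pow {1..n})"
proof -
  have "inj_on g (Pow {1..n})"
  proof (rule inj_onI)
    fix A B assume "A \<in> Pow {1..n}" "B \<in> Pow {1..n}" and eq: "g A = g B"
    then have A: "A \<subseteq> {1..n}" and B: "B \<subseteq> {1..n}"
      by auto
    have "coord i A = coord i B" if "i \<in> {1..n}" for i
      using that
    proof (induction i rule: less_induct)
      case (less i)
      have "A \<inter> {1..<i} = B \<inter> {1..<i}"
      proof -
        have "j \<in> A \<longleftrightarrow> j \<in> B" if "j \<in> {1..<i}" for j
          using less.IH[of j] less.prems that by (simp add: coord_eq_iff)
        then show ?thesis
          by blast
      qed
      then have "shift g i A = shift g i B"
        using triangular_restrict[OF g A less.prems] triangular_restrict[OF g B less.prems] by simp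
      moreover have "coord i A = coord i (g A) + shift g i A" "coord i B = coord i (g B) + shift g i B"
        by (simp_all add: shift_def)
      ultimately show ?case
        using eq by simp
    qed
    then show "A = B"
      by (rule coord_eqI[OF A B])
  qed
  moreover have "g ` Pow {1..n} \<subseteq> Pow {1..n}"
    using triangular_maps[OF g] by (intro image_subsetI PowI) simp
  ultimately show ?thesis
    unfolding bij_betw_def by (intro conjI endo_inj_surj) auto
qed

lemma triangular_cong:
  assumes "\<And>A. A \<subseteq> {1..n} \<Longrightarrow> g A = h A"
  shows "triangular n g \<longleftrightarrow> triangular n h"
proof -
  have "shift g i \<in> polys n F \<longleftrightarrow> shift h i \<in> polys n F" for i F
    by (rule polys_cong) (simp add: shift_def assms)
  then show ?thesis
    using assms by (simp add: triangular_def)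
qed

lemma perm_of_cong:
  assumes "\<And>A. A \<subseteq> {1..n} \<Longrightarrow> g A = h A"
  shows "perm_of n g = perm_of n h"
  using assms[OF dec_subset] by (simp add: perm_of_def fun_eq_iff)

lemma perm_of_comp:
  assumes "\<And>A. A \<subseteq> {1..n} \<Longrightarrow> h A \<subseteq> {1..n}"
  shows "perm_of n (\<lambda>A. g (h A)) = perm_of n g \<circ> perm_of n h"
proof
  fix x
  show "perm_of n (\<lambda>A. g (h A)) x = (perm_of n g \<circ> perm_of n h) x"
  proof (cases "x \<in> {1..2 ^ n}")
    case True
    have "h (dec n x) \<subseteq> {1..n}"
      by (rule assms[OF dec_subset])
    then have "enc n (h (dec n x)) \<in> {1..2 ^ n}" "dec n (enc n (h (dec n x))) = h (dec n x)"
      by (rule enc_in, rule dec_enc)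
    then show ?thesis
      using True by (simp only: perm_of_def comp_apply if_True)
  next
    case False
    then show ?thesis
      by (simp only: perm_of_def comp_apply if_False)
  qed
qed

lemma perm_of_act:
  assumes "p permutes {1..2 ^ n}"
  shows "perm_of n (act n p) = p"
  by (rule perm_eqI[OF perm_of_permutes[OF act_bij[OF assms]] assms])
     (rule act_perm_of[OF act_bij[OF assms]])

definition perms :: "nat \<Rightarrow> (nat set \<Rightarrow> nat set) set \<Rightarrow> (nat \<Rightarrow> nat) set" where
  "perms n M = {p. p permutes {1..2 ^ n} \<and> act n p \<in> M}"

lemma perms_subset: "perms n M \<subseteq> carrier (sym_group (2 ^ n))"
  by (auto simp: perms_def sym_group_carrier)

lemma finite_perms: "finite (perms n M)"
  by (rule finite_subset[OF perms_subset finite_sym_group])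

lemma perms_chain_subgroup:
  assumes "c \<le> n"
  shows "subgroup (perms n (chain n c)) (sym_group (2 ^ n))"
proof (rule group.finite_mult_closed_is_subgroup[OF sym_group_is_group perms_subset finite_perms])
  have "(\<lambda>A. A) \<in> chain n c"
    using translation_in_chain[of "{}" n c] by simp
  then have "act n id \<in> chain n c"
    by (rule chain_cong[THEN iffD2, rotated]) (rule act_id)
  then have "id \<in> perms n (chain n c)"
    by (simp add: perms_def permutes_id)
  then show "perms n (chain n c) \<noteq> {}"
    by blast
  fix p q assume p: "p \<in> perms n (chain n c)" and q: "q \<in> perms n (chain n c)"
  then have act: "act n p \<in> chain n c" "act n q \<in> chain n c" and qp: "q permutes {1..2 ^ n}"
    by (simp_all add: perms_def)
  have "(\<lambda>A. act n p (act n q A)) \<in> chain n c"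
    by (rule chain_comp[OF act assms])
  then have "act n (p \<circ> q) \<in> chain n c"
    by (rule chain_cong[THEN iffD2, rotated]) (rule act_comp[OF qp])
  then show "p \<otimes>\<^bsub>sym_group (2 ^ n)\<^esub> q \<in> perms n (chain n c)"
    using p q by (simp add: perms_def sym_group_mult permutes_compose)
qed

lemma perm_of_in_perms:
  assumes "triangular n g" "g \<in> chain n c"
  shows "perm_of n g \<in> perms n (chain n c)"
proof -
  note bij = triangular_bij[OF assms(1)]
  have "act n (perm_of n g) \<in> chain n c"
    using assms(2) by (rule chain_cong[THEN iffD2, rotated]) (rule act_perm_of[OF bij])
  then show ?thesis
    using perm_of_permutes[OF bij] by (simp add: perms_def)
qed

lemma act_conj:
  assumes p: "p permutes {1..2 ^ n}" and q: "q permutes {1..2 ^ n}" and A: "A \<subseteq> {1..n}"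
  shows "act n (p \<circ> q \<circ> inv' p) (act n p A) = act n p (act n q A)"
proof -
  have r: "p \<circ> q \<circ> inv' p permutes {1..2 ^ n}"
    using p q by (intro permutes_compose permutes_inv)
  have "p \<circ> q \<circ> inv' p \<circ> p = p \<circ> q"
    using permutes_inv_o(2)[OF p] by (simp add: comp_assoc)
  then show ?thesis
    using act_comp[OF p A, of "p \<circ> q \<circ> inv' p"] act_comp[OF q A, of p] by simp
qed

text \<open>
  Each map of the chain is a bijection of the points and is therefore the action of a
  permutation; this translates conjugation of permutations into the relation \<open>normalizes\<close>.
\<close>

lemma normalizer_chain_normalizes:
  assumes p: "p \<in> normalizer (sym_group (2 ^ n)) (perms n (chain n c))"
  shows "p permutes {1..2 ^ n}" "normalizes n (chain n c) (act n p)"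
proof -
  let ?P = "perms n (chain n c)"
  interpret group "sym_group (2 ^ n)"
    by (rule sym_group_is_group)
  have pc: "p \<in> carrier (sym_group (2 ^ n))"
    using p mem_normalizer_iff[OF perms_subset] by blast
  then show pp: "p permutes {1..2 ^ n}"
    by (simp add: sym_group_carrier)
  have conj: "(\<lambda>q. p \<circ> q \<circ> inv' p) ` ?P = ?P"
    using p mem_normalizer_iff[OF perms_subset] sym_group_inv_equality[OF pc] by (simp add: sym_group_mult)
  have lift: "perm_of n h \<in> ?P" "perm_of n h permutes {1..2 ^ n}"
    "\<And>A. A \<subseteq> {1..n} \<Longrightarrow> act n (perm_of n h) A = h A" if h: "h \<in> chain n c" for h
    using perm_of_in_perms[OF chain_triangular[OF h] h] act_perm_of[OF triangular_bij[OF chain_triangular[OF h]]]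
    by (auto simp: perms_def)
  show "normalizes n (chain n c) (act n p)"
    unfolding normalizes_def
  proof (intro conjI ballI)
    show "bij_betw (act n p) (Pow {1..n}) (Pow {1..n})"
      by (rule act_bij[OF pp])
  next
    fix h assume h: "h \<in> chain n c"
    define r where "r = p \<circ> perm_of n h \<circ> inv' p"
    have "r \<in> ?P"
      unfolding r_def using conj lift(1)[OF h] by blast
    moreover have "act n p (h A) = act n r (act n p A)" if "A \<subseteq> {1..n}" for A
      unfolding r_def act_conj[OF pp lift(2)[OF h] that] lift(3)[OF h that] ..
    ultimately show "\<exists>m\<in>chain n c. \<forall>A\<subseteq>{1..n}. act n p (h A) = m (act n p A)"
      by (auto simp: perms_def)
  next
    fix m assume m: "m \<in> chain n c"
    obtain q where q: "q \<in> ?P" "perm_of n m = p \<circ> q \<circ> inv' p"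
      using conj lift(1)[OF m] by blast
    then have qp: "q permutes {1..2 ^ n}"
      by (simp add: perms_def)
    have "act n p (act n q A) = m (act n p A)" if "A \<subseteq> {1..n}" for A
      using act_conj[OF pp qp that] lift(3)[OF m act_subset[of n p A]] q(2) by simp
    then show "\<exists>h\<in>chain n c. \<forall>A\<subseteq>{1..n}. act n p (h A) = m (act n p A)"
      using q(1) by (auto simp: perms_def)
  qed
qed

text \<open>
  With \<open>r = p q p\<inverse>\<close>, the shift of \<open>r\<close> at \<open>p A\<close> is the difference of the shift of \<open>p\<close> along \<open>q\<close>
  at \<open>A\<close> plus the shift of \<open>q\<close> at \<open>A\<close>. Both are within the bound for \<open>c\<close>, and substituting the
  action of \<open>p\<inverse>\<close> keeps them there.
\<close>

lemma chain_step_normalizes: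
  assumes c: "c < n" and p: "p \<in> perms n (chain n (Suc c))" and q: "q \<in> perms n (chain n c)"
  shows "p \<circ> q \<circ> inv' p \<in> perms n (chain n c)"
proof -
  have pp: "p permutes {1..2 ^ n}" and qp: "q permutes {1..2 ^ n}"
    and g: "act n p \<in> chain n (Suc c)" and h: "act n q \<in> chain n c"
    using p q by (auto simp: perms_def)
  let ?r = "p \<circ> q \<circ> inv' p" and ?g = "act n p" and ?h = "act n q"
  interpret P: subgroup "perms n (chain n (Suc c))" "sym_group (2 ^ n)"
    using c by (intro perms_chain_subgroup) simp
  have "inv\<^bsub>sym_group (2 ^ n)\<^esub> p \<in> perms n (chain n (Suc c))"
    using p by (rule P.m_inv_closed)
  then have g': "act n (inv' p) \<in> chain n (Suc c)"
    using pp by (simp add: perms_def sym_group_inv_equality sym_group_carrier)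
  have rp: "?r permutes {1..2 ^ n}"
    using pp qp by (intro permutes_compose permutes_inv)
  have "act n ?r \<in> chain n c"
  proof (rule chainI)
    fix i assume i: "i \<in> {1..n}"
    have diff: "(\<lambda>A. (shift ?g i (?h A) + shift ?g i A) + shift ?h i A) \<in> polys n (adm n c i)"
      using i by (intro polys_add[OF shift_compose_diff[OF chain_shift[OF g i] h c] chain_shift[OF h i]]) simp
    have "(\<lambda>B. (shift ?g i (?h (act n (inv' p) B)) + shift ?g i (act n (inv' p) B))
        + shift ?h i (act n (inv' p) B)) \<in> polys n (adm n c i)"
      by (rule polys_adm_compose[OF diff, where d = "Suc c"])
         (use c i act_subset chain_shift[OF g'] in auto)
    then show "shift (act n ?r) i \<in> polys n (adm n c i)"
    proof (rule polys_cong[THEN iffD1, rotated])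
      fix B :: "nat set" assume B: "B \<subseteq> {1..n}"
      let ?A = "act n (inv' p) B"
      have "?g ?A = B"
        using act_comp[OF permutes_inv[OF pp] B, of p] permutes_inv_o(1)[OF pp] act_id[OF B] by simp
      then have "act n ?r B = ?g (?h ?A)" "coord i B = coord i (?g ?A)"
        using act_conj[OF pp qp act_subset[of n "inv' p" B]] by simp_all
      then show "shift ?g i (?h ?A) + shift ?g i ?A + shift ?h i ?A = shift (act n ?r) i B"
        by (simp add: shift_def ac_simps)
    qed
  qed (rule act_subset)
  then show ?thesis
    using rp by (simp add: perms_def)
qed

theorem normalizer_perms_chain:
  assumes "2 \<le> c" "c < n"
  shows "normalizer (sym_group (2 ^ n)) (perms n (chain n c)) = perms n (chain n (Suc c))"
proof (intro equalityI subsetI)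
  fix p assume "p \<in> normalizer (sym_group (2 ^ n)) (perms n (chain n c))"
  note * = normalizer_chain_normalizes[OF this]
  then show "p \<in> perms n (chain n (Suc c))"
    using normalizer_in_chain[OF assms *(2)] by (simp add: perms_def)
next
  interpret group "sym_group (2 ^ n)"
    by (rule sym_group_is_group)
  fix p assume p: "p \<in> perms n (chain n (Suc c))"
  then have pc: "p \<in> carrier (sym_group (2 ^ n))"
    using perms_subset by blast
  then show "p \<in> normalizer (sym_group (2 ^ n)) (perms n (chain n c))"
    using chain_step_normalizes[OF assms(2) p]
    by (simp add: mem_normalizer_finite_iff[OF perms_subset finite_perms]
        sym_group_mult sym_group_inv_equality[OF pc])
qed

section \<open>The Sylow subgroup and the translations\<close>

lemma sym_group_comp_closed_generate:
  assumes "p \<in> generate (sym_group m) S" "q \<in> generate (sym_group m) S"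
  shows "p \<circ> q \<in> generate (sym_group m) S"
  using generate.eng[OF assms] by (simp add: sym_group_mult)

text \<open>
  For a set of involutions the inverses of generators need no separate treatment, so closure
  under products suffices.
\<close>

lemma generate_involutions_subset:
  assumes S: "\<And>p. p \<in> S \<Longrightarrow> p \<in> K \<and> p \<circ> p = id \<and> p permutes {1..m}"
    and id: "id \<in> K" and closed: "\<And>p q. p \<in> K \<Longrightarrow> q \<in> K \<Longrightarrow> p \<circ> q \<in> K"
  shows "generate (sym_group m) S \<subseteq> K"
proof
  fix p assume "p \<in> generate (sym_group m) S"
  then show "p \<in> K"
  proof induction
    case one
    show ?case
      unfolding sym_group_one by (rule id)
  next
    case (incl p)
    then show ?case
      using S by blast
  next
    case (inv p)
    then have "p \<in> carrier (sym_group m)" "p \<circ> p = id"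
      using S by (auto simp: sym_group_carrier)
    then have "inv\<^bsub>sym_group m\<^esub> p = p"
      by (simp add: sym_group_inv_equality inv_involution)
    then show ?case
      using S[OF inv] by simp
  next
    case (eng p q)
    then show ?case
      unfolding sym_group_mult by (intro closed)
  qed
qed

definition cond_flip :: "nat \<Rightarrow> (nat set \<Rightarrow> bit) \<Rightarrow> nat set \<Rightarrow> nat set" where
  "cond_flip i f A = (if f A = 1 then sym_diff A {i} else A)"

lemma shift_cond_flip: "shift (cond_flip i f) j A = (if j = i then f A else 0)"
  by (cases "f A") (auto simp: shift_def cond_flip_def coord_def)

lemma cond_flip_Int: "cond_flip i f A \<inter> {1..<i} = A \<inter> {1..<i}"
  by (auto simp: cond_flip_def)

lemma cond_flip_subset: "i \<in> {1..n} \<Longrightarrow> A \<subseteq> {1..n} \<Longrightarrow> cond_flip i f A \<subseteq> {1..n}"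
  by (auto simp: cond_flip_def)

lemma cond_flip_triangular:
  assumes i: "i \<in> {1..n}" and f: "\<And>A. A \<subseteq> {1..n} \<Longrightarrow> f (A \<inter> {1..<i}) = f A"
  shows "triangular n (cond_flip i f)"
  by (rule triangularI[OF cond_flip_subset[OF i]]) (simp_all only: shift_cond_flip f cong: if_cong)

lemma perms_triangular_comp:
  assumes p: "p \<in> perms n {g. triangular n g}" and q: "q \<in> perms n {g. triangular n g}"
  shows "p \<circ> q \<in> perms n {g. triangular n g}"
proof -
  have act: "triangular n (act n p)" "triangular n (act n q)"
    and pp: "p permutes {1..2 ^ n}" and qp: "q permutes {1..2 ^ n}"
    using p q by (simp_all add: perms_def)
  have "triangular n (\<lambda>A. act n p (act n q A))"
    by (rule triangular_comp[OF act])
  then have "triangular n (act n (p \<circ> q))"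
    by (rule triangular_cong[THEN iffD2, rotated]) (rule act_comp[OF qp])
  then show ?thesis
    using permutes_compose[OF qp pp] by (simp add: perms_def)
qed

lemma perm_of_id: "perm_of n (\<lambda>A. A) = id"
proof -
  have "perm_of n (\<lambda>A. A) = perm_of n (act n id)"
    by (rule perm_of_cong) (simp add: act_id)
  then show ?thesis
    using perm_of_act[OF permutes_id] by simp
qed

lemma id_in_perms:
  assumes "\<And>g h. (\<And>A. A \<subseteq> {1..n} \<Longrightarrow> g A = h A) \<Longrightarrow> h \<in> M \<Longrightarrow> g \<in> M" "(\<lambda>A. A) \<in> M"
  shows "id \<in> perms n M"
  using assms(1)[OF act_id assms(2)] by (simp add: perms_def permutes_id)

lemma s_gen_eq_perm_of:
  assumes i: "i \<in> {1..n}"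
  shows "s_gen (Suc (n - i)) = perm_of n (cond_flip i (\<lambda>A. of_bool (A \<inter> {1..<i} = {})))"
proof -
  have "s_gen (Suc (n - i)) permutes {1..2 ^ n}"
    using i by (intro s_gen_permutes) auto
  then have "s_gen (Suc (n - i)) = perm_of n (act n (s_gen (Suc (n - i))))"
    by (rule perm_of_act[symmetric])
  also have "\<dots> = perm_of n (cond_flip i (\<lambda>A. of_bool (A \<inter> {1..<i} = {})))"
    by (rule perm_of_cong) (simp only: act_s_gen[OF i] cond_flip_def of_bool_eq_1_iff)
  finally show ?thesis .
qed

lemma gen_index:
  assumes "k \<in> {1..n}"
  obtains i where "i \<in> {1..n}" "k = Suc (n - i)"
proof
  show "Suc n - k \<in> {1..n}" "k = Suc (n - (Suc n - k))"
    using assms by auto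
qed

lemma Sigma_grp_comp: "p \<in> Sigma_grp n \<Longrightarrow> q \<in> Sigma_grp n \<Longrightarrow> p \<circ> q \<in> Sigma_grp n"
  unfolding Sigma_grp_def by (rule sym_group_comp_closed_generate)

lemma id_in_Sigma_grp: "id \<in> Sigma_grp n"
  using generate.one[of "sym_group (2 ^ n)"] by (simp add: Sigma_grp_def sym_group_one)

lemma s_gen_in_Sigma_grp: "i \<in> {1..n} \<Longrightarrow> s_gen i \<in> Sigma_grp n"
  unfolding Sigma_grp_def by (rule generate.incl) simp

lemma Sigma_grp_subset_triangular: "Sigma_grp n \<subseteq> perms n {g. triangular n g}"
  unfolding Sigma_grp_def
proof (rule generate_involutions_subset)
  show "id \<in> perms n {g. triangular n g}"
  proof (rule id_in_perms)
    show "(\<lambda>A. A) \<in> {g. triangular n g}"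
      by (auto intro!: triangularI simp: shift_def)
    show "g \<in> {g. triangular n g}" if "\<And>A. A \<subseteq> {1..n} \<Longrightarrow> g A = h A" "h \<in> {g. triangular n g}" for g h
      using triangular_cong[of n g h] that by blast
  qed
next
  fix p assume "p \<in> s_gen ` {1..n}"
  then obtain k where k: "k \<in> {1..n}" "p = s_gen k"
    by blast
  obtain i where i: "i \<in> {1..n}" "k = Suc (n - i)"
    using k(1) by (rule gen_index)
  let ?g = "cond_flip i (\<lambda>A. of_bool (A \<inter> {1..<i} = {}))"
  have tri: "triangular n ?g"
    by (rule cond_flip_triangular[OF i(1)]) (simp add: Int_assoc)
  have p: "p = perm_of n ?g"
    using s_gen_eq_perm_of[OF i(1)] k i by simp
  have "triangular n (act n p)"
    unfolding p using tri
    by (rule triangular_cong[THEN iffD2, rotated]) (rule act_perm_of[OF triangular_bij[OF tri]])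
  moreover have "p \<circ> p = id" "p permutes {1..2 ^ n}"
    using s_gen_involution[of "n - i"] s_gen_permutes[OF k(1)] k i by simp_all
  ultimately show "p \<in> perms n {g. triangular n g} \<and> p \<circ> p = id \<and> p permutes {1..2 ^ n}"
    by (simp add: perms_def)
qed (rule perms_triangular_comp)

text \<open>
  Conjugating the generator, which flips \<open>x_i\<close> where all preceding coordinates vanish, by a
  translation in those coordinates gives the flip of \<open>x_i\<close> on a single value of them. Products
  of such maps flip \<open>x_i\<close> under an arbitrary condition on the preceding coordinates.
\<close>

lemma cond_flip_in_Sigma_grp:
  assumes i: "i \<in> {1..n}"
    and trans: "\<And>B. B \<subseteq> {1..<i} \<Longrightarrow> perm_of n (\<lambda>A. sym_diff A B) \<in> Sigma_grp n"
    and X: "X \<subseteq> Pow {1..<i}"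
  shows "perm_of n (cond_flip i (\<lambda>A. of_bool (A \<inter> {1..<i} \<in> X))) \<in> Sigma_grp n"
proof -
  let ?F = "\<lambda>X. cond_flip i (\<lambda>A. of_bool (A \<inter> {1..<i} \<in> X))"
  have delta: "perm_of n (?F {B}) \<in> Sigma_grp n" if B: "B \<subseteq> {1..<i}" for B
  proof -
    let ?t = "\<lambda>A. sym_diff A B" and ?s = "cond_flip i (\<lambda>A. of_bool (A \<inter> {1..<i} = {}))"
    have tsub: "?t A \<subseteq> {1..n}" if "A \<subseteq> {1..n}" for A
      using that B i by fastforce
    have s: "perm_of n ?s \<in> Sigma_grp n"
      unfolding s_gen_eq_perm_of[OF i, symmetric] using i by (intro s_gen_in_Sigma_grp) auto
    have eq: "?F {B} A = ?t (?s (?t A))" for A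
    proof -
      have "?t A \<inter> {1..<i} = {} \<longleftrightarrow> A \<inter> {1..<i} = B"
        using B by blast
      then show ?thesis
        by (auto simp: cond_flip_def)
    qed
    have "perm_of n (?F {B}) = perm_of n (\<lambda>A. ?t (?s (?t A)))"
      by (rule perm_of_cong) (rule eq)
    also have "\<dots> = perm_of n ?t \<circ> (perm_of n ?s \<circ> perm_of n ?t)"
      using perm_of_comp[of n "\<lambda>A. ?s (?t A)" ?t] perm_of_comp[of n ?t ?s]
        cond_flip_subset[OF i tsub] tsub by simp
    finally show ?thesis
      using Sigma_grp_comp[OF trans[OF B] Sigma_grp_comp[OF s trans[OF B]]] by simp
  qed
  have "finite X"
    using X by (rule finite_subset) auto
  then show ?thesis
    using X
  proof (induction X rule: finite_induct)
    case empty
    have "?F {} = (\<lambda>A. A)"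
      by (simp add: cond_flip_def fun_eq_iff)
    then show ?case
      by (simp only: perm_of_id id_in_Sigma_grp)
  next
    case (insert B X)
    have "?F (insert B X) A = ?F {B} (?F X A)" for A
    proof -
      have "?F X A \<inter> {1..<i} = A \<inter> {1..<i}"
        by (rule cond_flip_Int)
      then show ?thesis
        using insert.hyps by (auto simp: cond_flip_def)
    qed
    then have "perm_of n (?F (insert B X)) = perm_of n (\<lambda>A. ?F {B} (?F X A))"
      by (intro perm_of_cong)
    also have "\<dots> = perm_of n (?F {B}) \<circ> perm_of n (?F X)"
      by (rule perm_of_comp[OF cond_flip_subset[OF i]])
    finally show ?case
      using insert.prems by (simp only:) (intro Sigma_grp_comp delta insert.IH; simp)
  qed
qed

text \<open>
  A triangular map affecting only the first \<open>Suc k\<close> coordinates is a conditional flip of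
  coordinate \<open>Suc k\<close> followed by a triangular map affecting only the first \<open>k\<close>. The translations
  that the conditional flip requires are themselves of the latter kind.
\<close>

lemma triangular_below_in_Sigma_grp:
  assumes "k \<le> n" "triangular n g"
    and "\<And>i A. i \<in> {1..n} \<Longrightarrow> k < i \<Longrightarrow> A \<subseteq> {1..n} \<Longrightarrow> shift g i A = 0"
  shows "perm_of n g \<in> Sigma_grp n"
  using assms
proof (induction k arbitrary: g)
  case 0
  have "g A = A" if A: "A \<subseteq> {1..n}" for A
  proof (rule coord_eqI[OF triangular_maps[OF 0(2) A] A])
    fix i assume "i \<in> {1..n}"
    then show "coord i (g A) = coord i A"
      using 0(3)[of i A] A by (simp add: coord_image)
  qed
  then have "perm_of n g = perm_of n (\<lambda>A. A)"
    by (rule perm_of_cong)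
  then show ?case
    by (simp only: perm_of_id id_in_Sigma_grp)
next
  case (Suc k)
  define i where "i = Suc k"
  have i: "i \<in> {1..n}"
    using Suc.prems by (simp add: i_def)
  note g = Suc.prems(2)
  define X where "X = {B. B \<subseteq> {1..<i} \<and> shift g i B = 1}"
  define s where "s = cond_flip i (\<lambda>A. of_bool (A \<inter> {1..<i} \<in> X))"
  have sX: "of_bool (A \<inter> {1..<i} \<in> X) = shift g i A" if "A \<subseteq> {1..n}" for A
    using triangular_restrict[OF g that i] by (cases "shift g i A") (auto simp: X_def)
  have ssub: "s A \<subseteq> {1..n}" if "A \<subseteq> {1..n}" for A
    unfolding s_def by (rule cond_flip_subset[OF i that])
  have trans: "perm_of n (\<lambda>A. sym_diff A B) \<in> Sigma_grp n" if B: "B \<subseteq> {1..<i}" for B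
  proof (rule Suc.IH)
    show "triangular n (\<lambda>A. sym_diff A B)"
      using B i by (intro chain_triangular[of _ n 0] translation_in_chain) fastforce
    show "shift (\<lambda>A. sym_diff A B) j A = 0" if "k < j" for j A
      using that B by (auto simp: shift_translation coord_def i_def)
  qed (use Suc.prems in simp)
  have sS: "perm_of n s \<in> Sigma_grp n"
    unfolding s_def by (rule cond_flip_in_Sigma_grp[OF i trans]) (auto simp: X_def)
  have stri: "triangular n s"
    unfolding s_def by (rule cond_flip_triangular[OF i]) (simp add: Int_assoc)
  have qS: "perm_of n (\<lambda>A. g (s A)) \<in> Sigma_grp n"
  proof (rule Suc.IH)
    show "triangular n (\<lambda>A. g (s A))"
      by (rule triangular_comp[OF g stri])
    fix j A assume j: "j \<in> {1..n}" "k < j" and A: "A \<subseteq> {1..n}"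
    show "shift (\<lambda>A. g (s A)) j A = 0"
    proof (cases "j = i")
      case True
      have "shift g i (s A) = shift g i (s A \<inter> {1..<i})"
        by (rule triangular_restrict[OF g ssub[OF A] i, symmetric])
      also have "s A \<inter> {1..<i} = A \<inter> {1..<i}"
        unfolding s_def by (rule cond_flip_Int)
      also have "shift g i (A \<inter> {1..<i}) = shift g i A"
        by (rule triangular_restrict[OF g A i])
      finally show ?thesis
        using True sX[OF A] by (simp add: shift_comp s_def shift_cond_flip)
    next
      case False
      then show ?thesis
        using Suc.prems(3)[OF j(1) _ ssub[OF A]] j
        by (simp add: shift_comp s_def shift_cond_flip i_def)
    qed
  qed (use Suc.prems in simp)
  have "s (s A) = A" for A
  proof -
    have "s A \<inter> {1..<i} = A \<inter> {1..<i}"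
      unfolding s_def by (rule cond_flip_Int)
    then show ?thesis
      by (auto simp: s_def cond_flip_def)
  qed
  then have "perm_of n g = perm_of n (\<lambda>A. g (s (s A)))"
    by simp
  also have "\<dots> = perm_of n (\<lambda>A. g (s A)) \<circ> perm_of n s"
    by (rule perm_of_comp[where g = "\<lambda>A. g (s A)" and h = s, OF ssub])
  finally show ?case
    using Sigma_grp_comp[OF qS sS] by (simp only:)
qed

lemma Sigma_grp_eq: "Sigma_grp n = perms n {g. triangular n g}"
proof (rule antisym[OF Sigma_grp_subset_triangular subsetI])
  fix p assume p: "p \<in> perms n {g. triangular n g}"
  then have "perm_of n (act n p) \<in> Sigma_grp n"
    by (intro triangular_below_in_Sigma_grp[of n]) (auto simp: perms_def)
  then show "p \<in> Sigma_grp n"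
    using p by (simp add: perms_def perm_of_act)
qed

definition translation_maps :: "nat \<Rightarrow> (nat set \<Rightarrow> nat set) set" where
  "translation_maps n = {g. \<exists>v\<subseteq>{1..n}. \<forall>A\<subseteq>{1..n}. g A = sym_diff A v}"

lemma perms_translations_comp:
  assumes "p \<in> perms n (translation_maps n)" "q \<in> perms n (translation_maps n)"
  shows "p \<circ> q \<in> perms n (translation_maps n)"
proof -
  obtain v w where v: "v \<subseteq> {1..n}" "\<And>A. A \<subseteq> {1..n} \<Longrightarrow> act n p A = sym_diff A v"
      and w: "w \<subseteq> {1..n}" "\<And>A. A \<subseteq> {1..n} \<Longrightarrow> act n q A = sym_diff A w"
    and pp: "p permutes {1..2 ^ n}" and qp: "q permutes {1..2 ^ n}"
    using assms by (auto simp: perms_def translation_maps_def)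
  have "act n (p \<circ> q) A = sym_diff A (sym_diff v w)" if A: "A \<subseteq> {1..n}" for A
  proof -
    have "sym_diff A w \<subseteq> {1..n}"
      using A w(1) by blast
    then have "act n (p \<circ> q) A = sym_diff (sym_diff A w) v"
      unfolding act_comp[OF qp A] w(2)[OF A] by (rule v(2))
    then show ?thesis
      by auto
  qed
  moreover have "sym_diff v w \<subseteq> {1..n}"
    using v w by blast
  ultimately have "act n (p \<circ> q) \<in> translation_maps n"
    unfolding translation_maps_def by blast
  then show ?thesis
    using permutes_compose[OF qp pp] by (simp add: perms_def)
qed

lemma T_grp_subset: "T_grp n \<subseteq> perms n (translation_maps n)"
  unfolding T_grp_def
proof (rule generate_involutions_subset)
  show "id \<in> perms n (translation_maps n)"
    by (rule id_in_perms) (auto simp: translation_maps_def)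
next
  fix p assume "p \<in> t_gen n ` {1..n}"
  then obtain k where k: "k \<in> {1..n}" "p = t_gen n k"
    by blast
  obtain i where i: "i \<in> {1..n}" "k = Suc (n - i)"
    using k(1) by (rule gen_index)
  have "act n p \<in> translation_maps n"
    unfolding translation_maps_def using i act_t_gen[OF i(1)] k
    by (intro CollectI exI[of _ "{i}"]) simp
  moreover have "p \<circ> p = id" "p permutes {1..2 ^ n}"
    using t_gen_involution[of "n - i" n] t_gen_permutes[OF k(1)] k i by auto
  ultimately show "p \<in> perms n (translation_maps n) \<and> p \<circ> p = id \<and> p permutes {1..2 ^ n}"
    by (simp add: perms_def)
qed (rule perms_translations_comp)

lemma T_grp_comp: "p \<in> T_grp n \<Longrightarrow> q \<in> T_grp n \<Longrightarrow> p \<circ> q \<in> T_grp n"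
  unfolding T_grp_def by (rule sym_group_comp_closed_generate)

lemma translation_in_T_grp:
  assumes "v \<subseteq> {1..n}"
  shows "perm_of n (\<lambda>A. sym_diff A v) \<in> T_grp n"
proof -
  have "finite v"
    using assms by (rule finite_subset) auto
  then show ?thesis
    using assms
  proof (induction v rule: finite_induct)
    case empty
    have "(\<lambda>A. sym_diff A {}) = (\<lambda>A :: nat set. A)"
      by simp
    then show ?case
      using generate.one[of "sym_group (2 ^ n)"]
      by (simp only: T_grp_def sym_group_one perm_of_id)
  next
    case (insert i v)
    then have i: "i \<in> {1..n}" and v: "v \<subseteq> {1..n}"
      by auto
    have "t_gen n (Suc (n - i)) = perm_of n (act n (t_gen n (Suc (n - i))))"
      using i by (intro perm_of_act[symmetric] t_gen_permutes) auto
    also have "\<dots> = perm_of n (\<lambda>A. sym_diff A {i})"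
      by (rule perm_of_cong) (rule act_t_gen[OF i])
    finally have "perm_of n (\<lambda>A. sym_diff A {i}) = t_gen n (Suc (n - i))"
      by (rule sym)
    moreover have "t_gen n (Suc (n - i)) \<in> T_grp n"
      unfolding T_grp_def using i by (intro generate.incl imageI) auto
    ultimately have ti: "perm_of n (\<lambda>A. sym_diff A {i}) \<in> T_grp n"
      by (simp only:)
    have eq: "sym_diff A (insert i v) = sym_diff (sym_diff A v) {i}" for A
      using insert.hyps by auto
    have "perm_of n (\<lambda>A. sym_diff A (insert i v))
        = perm_of n (\<lambda>A. sym_diff A {i}) \<circ> perm_of n (\<lambda>A. sym_diff A v)"
      unfolding eq
    proof (rule perm_of_comp)
      show "sym_diff A v \<subseteq> {1..n}" if "A \<subseteq> {1..n}" for A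
        using that v by blast
    qed
    then show ?case
      by (simp only:) (rule T_grp_comp[OF ti insert.IH[OF v]])
  qed
qed

lemma T_grp_eq: "T_grp n = perms n (translation_maps n)"
proof (rule antisym[OF T_grp_subset subsetI])
  fix p assume "p \<in> perms n (translation_maps n)"
  then obtain v where p: "p permutes {1..2 ^ n}" and v: "v \<subseteq> {1..n}"
    "\<And>A. A \<subseteq> {1..n} \<Longrightarrow> act n p A = sym_diff A v"
    by (auto simp: perms_def translation_maps_def)
  have "p = perm_of n (act n p)"
    using perm_of_act[OF p] by simp
  also have "\<dots> = perm_of n (\<lambda>A. sym_diff A v)"
    by (rule perm_of_cong) (rule v(2))
  finally show "p \<in> T_grp n"
    using translation_in_T_grp[OF v(1)] by simp
qed

section \<open>The start of the chain\<close>

lemma affine_sym_diff: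
  assumes f: "f \<in> polys n {S. card S \<le> 1}" and A: "A \<subseteq> {1..n}" and B: "B \<subseteq> {1..n}"
  shows "f (sym_diff A B) = f A + f B + f {}"
proof -
  have "zeta f S * of_bool (S \<subseteq> sym_diff A B)
      = zeta f S * of_bool (S \<subseteq> A) + zeta f S * of_bool (S \<subseteq> B) + zeta f S * of_bool (S \<subseteq> {})"
    if S: "S \<in> Pow {1..n}" for S
  proof (cases "zeta f S = 0")
    case False
    have "card S \<le> 1"
      using polysD[OF f _ False] S by simp
    moreover have "finite S"
      using S by (auto intro: finite_subset)
    ultimately have "of_bool (S \<subseteq> sym_diff A B)
        = of_bool (S \<subseteq> A) + of_bool (S \<subseteq> B) + (of_bool (S \<subseteq> {}) :: bit)"
      by (elim card_le_1_cases) auto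
    then show ?thesis
      by (simp only: distrib_left)
  qed simp
  moreover have "sym_diff A B \<subseteq> {1..n}"
    using A B by blast
  ultimately show ?thesis
    unfolding monomial_expansion[OF A, of f] monomial_expansion[OF B, of f]
      monomial_expansion[OF empty_subsetI, of f n] sum.distrib[symmetric]
    by (subst monomial_expansion[of _ n]) (auto intro!: sum.cong)
qed

text \<open>
  A monomial with at least two factors would leave a nonconstant monomial in the difference
  along each of them.
\<close>

lemma degree_le_1_if_constant_differences:
  assumes "\<And>j. j \<in> {1..n} \<Longrightarrow> \<exists>a. \<forall>A\<subseteq>{1..n}. f (sym_diff A {j}) + f A = a"
  shows "f \<in> polys n {S. card S \<le> 1}"
  unfolding polys_def
proof (intro CollectI allI impI)
  fix S assume S: "S \<subseteq> {1..n}" "zeta f S \<noteq> 0"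
  have fin: "finite S"
    using S(1) by (rule finite_subset) auto
  show "card S \<le> 1"
  proof (cases "S = {}")
    case False
    then obtain j where j: "j \<in> S"
      by blast
    define R where "R = S - {j}"
    have R: "finite R" "j \<notin> R" "insert j R = S" "R \<subseteq> {1..n}"
      using j fin S(1) by (auto simp: R_def)
    have "j \<in> {1..n}"
      using S(1) j by blast
    then obtain a where a: "\<And>A. A \<subseteq> {1..n} \<Longrightarrow> f (sym_diff A {j}) + f A = a"
      using assms by blast
    have "zeta (\<lambda>A. f (sym_diff A {j}) + f A) R = zeta (\<lambda>A. a) R"
      by (rule zeta_cong) (use a R(4) in blast)
    then have "zeta (\<lambda>A. a) R \<noteq> 0"
      using zeta_translation_diff[OF R(1,2), of f] R(3) S(2) by simp
    then have "R \<in> {{}}"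
      by (rule polysD[OF polys_const[of "{{}}" a n] R(4), rotated]) simp
    then have "S = {j}"
      using R(3) by simp
    then show ?thesis
      by simp
  qed simp
qed

text \<open>
  Conjugates of translations by \<open>g\<close> are translations only if all differences of its shifts are
  constant.
\<close>

lemma chain_2I:
  assumes g: "triangular n g"
    and conj: "\<And>j. j \<in> {1..n} \<Longrightarrow> \<exists>w. \<forall>A\<subseteq>{1..n}. g (sym_diff A {j}) = sym_diff (g A) w"
  shows "g \<in> chain n 2"
proof (rule chainI)
  fix i assume i: "i \<in> {1..n}"
  have "shift g i \<in> polys n {S. card S \<le> 1}"
  proof (rule degree_le_1_if_constant_differences)
    fix j assume j: "j \<in> {1..n}"
    obtain w where w: "\<forall>A\<subseteq>{1..n}. g (sym_diff A {j}) = sym_diff (g A) w"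
      using conj[OF j] ..
    have "shift g i (sym_diff A {j}) + shift g i A = coord i w + coord i {j}" if "A \<subseteq> {1..n}" for A
      unfolding shift_def w[rule_format, OF that] coord_sym_diff by (simp add: ac_simps)
    then show "\<exists>a. \<forall>A\<subseteq>{1..n}. shift g i (sym_diff A {j}) + shift g i A = a"
      by (intro exI[of _ "coord i w + coord i {j}"] allI impI)
  qed
  moreover have "shift g i \<in> polys n (Pow {1..<i})"
    using g i by (simp add: triangular_def)
  ultimately have "shift g i \<in> polys n ({S. card S \<le> 1} \<inter> Pow {1..<i})"
    by (rule polys_Int)
  then show "shift g i \<in> polys n (adm n 2 i)"
    by (rule polys_mono) (use i in \<open>simp add: adm_2\<close>)
qed (rule triangular_maps[OF g])

lemma chain_2_translation:
  assumes g: "g \<in> chain n 2" and v: "v \<subseteq> {1..n}" and A: "A \<subseteq> {1..n}"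
  shows "g (sym_diff A v) = sym_diff (g A) (sym_diff (g v) (g {}))"
proof (rule coord_eqI)
  have sub: "g A \<subseteq> {1..n}" "g v \<subseteq> {1..n}" "g {} \<subseteq> {1..n}"
    using chain_maps[OF g] A v by auto
  have "sym_diff A v \<subseteq> {1..n}"
    using A v by blast
  then show "g (sym_diff A v) \<subseteq> {1..n}"
    by (rule chain_maps[OF g])
  show "sym_diff (g A) (sym_diff (g v) (g {})) \<subseteq> {1..n}"
    using sub by blast
  fix i assume i: "i \<in> {1..n}"
  have "shift g i \<in> polys n {S. card S \<le> 1}"
    using chain_shift[OF g i] by (rule polys_mono) (use i in \<open>simp add: adm_2\<close>)
  note aff = affine_sym_diff[OF this A v]
  have "coord i ({} :: nat set) = 0"
    by (simp add: coord_def)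
  then show "coord i (g (sym_diff A v)) = coord i (sym_diff (g A) (sym_diff (g v) (g {})))"
    unfolding coord_sym_diff coord_image[of i g] aff by (simp add: ac_simps)
qed

lemma Sigma_grp_subgroup: "subgroup (Sigma_grp n) (sym_group (2 ^ n))"
  unfolding Sigma_grp_def
proof (rule group.generate_is_subgroup[OF sym_group_is_group])
  show "s_gen ` {1..n} \<subseteq> carrier (sym_group (2 ^ n))"
    by (intro image_subsetI) (simp only: sym_group_carrier s_gen_permutes)
qed

lemma perms_mono: "M \<subseteq> N \<Longrightarrow> perms n M \<subseteq> perms n N"
  by (auto simp: perms_def)

lemma translation_maps_triangular: "translation_maps n \<subseteq> {g. triangular n g}"
proof
  fix g assume "g \<in> translation_maps n"
  then obtain v where v: "v \<subseteq> {1..n}" "\<And>A. A \<subseteq> {1..n} \<Longrightarrow> g A = sym_diff A v"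
    by (auto simp: translation_maps_def)
  have "triangular n (\<lambda>A. sym_diff A v)"
    by (rule chain_triangular[OF translation_in_chain[OF v(1), of 0]])
  then have "triangular n g"
    by (rule triangular_cong[THEN iffD2, rotated]) (rule v(2))
  then show "g \<in> {g. triangular n g}"
    by simp
qed

lemma U_grp_mem_iff:
  "p \<in> U_grp n \<longleftrightarrow> p \<in> Sigma_grp n \<and> (\<forall>t\<in>T_grp n. p \<circ> t \<circ> inv' p \<in> T_grp n)"
proof -
  let ?S = "sym_group (2 ^ n)"
  let ?G = "?S\<lparr>carrier := Sigma_grp n\<rparr>"
  interpret S: group ?S
    by (rule sym_group_is_group)
  interpret G: group ?G
    by (rule S.subgroup_imp_group[OF Sigma_grp_subgroup])
  have T: "T_grp n \<subseteq> carrier ?G" "finite (T_grp n)"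
    using perms_mono[OF translation_maps_triangular] finite_perms
    by (auto simp: T_grp_eq Sigma_grp_eq)
  have "p \<otimes>\<^bsub>?G\<^esub> t \<otimes>\<^bsub>?G\<^esub> inv\<^bsub>?G\<^esub> p = p \<circ> t \<circ> inv' p" if p: "p \<in> Sigma_grp n" for t
  proof -
    have "p \<in> carrier ?S"
      using p subgroup.subset[OF Sigma_grp_subgroup] by blast
    then show ?thesis
      using S.m_inv_consistent[OF Sigma_grp_subgroup p]
      by (simp add: sym_group_mult sym_group_inv_equality)
  qed
  then show ?thesis
    unfolding U_grp_def G.mem_normalizer_finite_iff[OF T] by auto
qed

text \<open>
  Within the triangular permutations, normalizing the translations means being affine.
\<close>

lemma U_grp_eq: "U_grp n = perms n (chain n 2)"
proof (intro equalityI subsetI)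
  fix p assume p: "p \<in> U_grp n"
  then have pp: "p permutes {1..2 ^ n}" and tri: "triangular n (act n p)"
    and conj: "\<And>t. t \<in> T_grp n \<Longrightarrow> p \<circ> t \<circ> inv' p \<in> T_grp n"
    by (auto simp: U_grp_mem_iff Sigma_grp_eq perms_def)
  have "act n p \<in> chain n 2"
  proof (rule chain_2I[OF tri])
    fix j assume j: "j \<in> {1..n}"
    define t where "t = perm_of n (\<lambda>A. sym_diff A {j})"
    have jn: "{j} \<subseteq> {1..n}"
      using j by simp
    have bij: "bij_betw (\<lambda>A. sym_diff A {j}) (Pow {1..n}) (Pow {1..n})"
      by (rule triangular_bij[OF chain_triangular[OF translation_in_chain[OF jn, of 0]]])
    have tp: "t permutes {1..2 ^ n}"
      unfolding t_def by (rule perm_of_permutes[OF bij])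
    have "t \<in> T_grp n"
      unfolding t_def by (rule translation_in_T_grp[OF jn])
    then have "p \<circ> t \<circ> inv' p \<in> perms n (translation_maps n)"
      using conj T_grp_eq by simp
    then obtain w where w: "\<And>A. A \<subseteq> {1..n} \<Longrightarrow> act n (p \<circ> t \<circ> inv' p) A = sym_diff A w"
      by (auto simp: perms_def translation_maps_def)
    have "act n p (sym_diff A {j}) = sym_diff (act n p A) w" if A: "A \<subseteq> {1..n}" for A
      using act_conj[OF pp tp A] w[OF act_subset, of p A] act_perm_of[OF bij A] by (simp add: t_def)
    then show "\<exists>w. \<forall>A\<subseteq>{1..n}. act n p (sym_diff A {j}) = sym_diff (act n p A) w"
      by (intro exI[of _ w] allI impI)
  qed
  then show "p \<in> perms n (chain n 2)"
    using pp by (simp add: perms_def)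
next
  fix p assume p: "p \<in> perms n (chain n 2)"
  then have pp: "p permutes {1..2 ^ n}" and g: "act n p \<in> chain n 2"
    by (auto simp: perms_def)
  have "p \<circ> t \<circ> inv' p \<in> T_grp n" if t: "t \<in> T_grp n" for t
  proof -
    obtain v where tp: "t permutes {1..2 ^ n}" and v: "v \<subseteq> {1..n}"
      "\<And>A. A \<subseteq> {1..n} \<Longrightarrow> act n t A = sym_diff A v"
      using t by (auto simp: T_grp_eq perms_def translation_maps_def)
    let ?w = "sym_diff (act n p v) (act n p {})"
    have "act n (p \<circ> t \<circ> inv' p) B = sym_diff B ?w" if B: "B \<subseteq> {1..n}" for B
    proof -
      let ?A = "act n (inv' p) B"
      have "act n p ?A = B"
        using act_comp[OF permutes_inv[OF pp] B, of p] permutes_inv_o(1)[OF pp] act_id[OF B] by simp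
      then show ?thesis
        using act_conj[OF pp tp act_subset[of n "inv' p" B]] v(2)[OF act_subset[of n "inv' p" B]]
          chain_2_translation[OF g v(1) act_subset[of n "inv' p" B]] by simp
    qed
    moreover have "?w \<subseteq> {1..n}"
      using act_subset[of n p v] act_subset[of n p "{}"] by blast
    ultimately have "act n (p \<circ> t \<circ> inv' p) \<in> translation_maps n"
      unfolding translation_maps_def by blast
    moreover have "p \<circ> t \<circ> inv' p permutes {1..2 ^ n}"
      using pp tp by (intro permutes_compose permutes_inv)
    ultimately show ?thesis
      by (simp add: T_grp_eq perms_def)
  qed
  then show "p \<in> U_grp n"
    using pp chain_triangular[OF g] by (simp add: U_grp_mem_iff Sigma_grp_eq perms_def)
qed

theorem norm_chain_eq:
  assumes "k + 2 \<le> n"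
  shows "norm_chain n k = perms n (chain n (k + 2))"
  using assms
proof (induction k)
  case 0
  show ?case
    unfolding norm_chain.simps add_0 by (rule U_grp_eq)
next
  case (Suc k)
  then have "norm_chain n (Suc k) = normalizer (sym_group (2 ^ n)) (perms n (chain n (k + 2)))"
    by simp
  also have "\<dots> = perms n (chain n (Suc (k + 2)))"
    using Suc.prems by (intro normalizer_perms_chain) auto
  finally show ?case
    by simp
qed

section \<open>Orders and indices\<close>

lemma finite_adm: "finite (adm n c i)"
  by (rule finite_subset[of _ "Pow {1..<i}"]) (auto simp: adm_def)

text \<open>
  A map of the chain is determined by the coefficients of its shifts, and any choice of
  coefficients of admissible monomials gives a triangular map, hence a permutation.
\<close>

lemma card_perms_chain: "card (perms n (chain n c)) = 2 ^ card (Sigma {1..n} (adm n c))"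
proof -
  define \<Phi> where "\<Phi> p = {(i, S). i \<in> {1..n} \<and> S \<subseteq> {1..n} \<and> zeta (shift (act n p) i) S = 1}" for p
  have "bij_betw \<Phi> (perms n (chain n c)) (Pow (Sigma {1..n} (adm n c)))"
    unfolding bij_betw_def
  proof (intro conjI equalityI)
    show "inj_on \<Phi> (perms n (chain n c))"
    proof (rule inj_onI)
      fix p q assume p: "p \<in> perms n (chain n c)" and q: "q \<in> perms n (chain n c)" and eq: "\<Phi> p = \<Phi> q"
      have z: "zeta (shift (act n p) i) S = zeta (shift (act n q) i) S"
        if "i \<in> {1..n}" "S \<subseteq> {1..n}" for i S
      proof -
        have "(i, S) \<in> \<Phi> p \<longleftrightarrow> (i, S) \<in> \<Phi> q"
          using eq by simp
        then show ?thesis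
          using that unfolding \<Phi>_def by (subst bit_eq_iff_1) simp
      qed
      have "act n p A = act n q A" if A: "A \<subseteq> {1..n}" for A
      proof (rule coord_eqI[OF act_subset act_subset])
        fix i assume i: "i \<in> {1..n}"
        have "zeta (zeta (shift (act n p) i)) A = zeta (zeta (shift (act n q) i)) A"
          by (rule zeta_cong, rule z[OF i]) (use A in blast)
        then have "shift (act n p) i A = shift (act n q) i A"
          by (simp only: zeta_zeta[OF finite_cube[OF A]])
        then show "coord i (act n p A) = coord i (act n q A)"
          by (simp add: coord_image)
      qed
      then show "p = q"
        using p q by (intro perm_eqI[of p n q]) (auto simp: perms_def)
    qed
    show "\<Phi> ` perms n (chain n c) \<subseteq> Pow (Sigma {1..n} (adm n c))"
    proof (intro image_subsetI PowI subsetI)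
      fix p x assume p: "p \<in> perms n (chain n c)" and "x \<in> \<Phi> p"
      then obtain i S where x: "x = (i, S)" "i \<in> {1..n}" "S \<subseteq> {1..n}" "zeta (shift (act n p) i) S \<noteq> 0"
        by (auto simp: \<Phi>_def)
      have "S \<in> adm n c i"
        using p by (intro polysD[OF chain_shift[OF _ x(2)] x(3,4)]) (simp add: perms_def)
      then show "x \<in> Sigma {1..n} (adm n c)"
        using x by simp
    qed
    show "Pow (Sigma {1..n} (adm n c)) \<subseteq> \<Phi> ` perms n (chain n c)"
    proof
      fix C assume "C \<in> Pow (Sigma {1..n} (adm n c))"
      then have C: "C \<subseteq> Sigma {1..n} (adm n c)"
        by simp
      define f where "f i = zeta (\<lambda>S. of_bool ((i, S) \<in> C))" for i
      define g where "g A = {i \<in> {1..n}. coord i A + f i A = 1}" for A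
      have shift: "shift g i = f i" if "i \<in> {1..n}" for i
      proof
        fix A
        have "coord i (g A) = 1 \<longleftrightarrow> i \<in> g A"
          by (simp add: coord_def)
        also have "\<dots> \<longleftrightarrow> coord i A + f i A = 1"
          using that by (simp add: g_def)
        finally have "coord i (g A) = coord i A + f i A"
          by (rule bit_eq_iff_1[THEN iffD2])
        then show "shift g i A = f i A"
          by (simp add: shift_def ac_simps)
      qed
      have g: "g \<in> chain n c"
      proof (rule chainI)
        show "g A \<subseteq> {1..n}" for A
          by (auto simp: g_def)
        fix i assume i: "i \<in> {1..n}"
        show "shift g i \<in> polys n (adm n c i)"
          unfolding shift[OF i]
          by (rule polysI[where c = "\<lambda>S. of_bool ((i, S) \<in> C)"])
             (use C in \<open>auto simp: f_def split: if_splits\<close>)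
      qed
      note tri = chain_triangular[OF g]
      have p: "perm_of n g \<in> perms n (chain n c)"
        by (rule perm_of_in_perms[OF tri g])
      have z: "zeta (shift (act n (perm_of n g)) i) S = of_bool ((i, S) \<in> C)"
        if i: "i \<in> {1..n}" and S: "S \<subseteq> {1..n}" for i S
      proof -
        have "zeta (shift (act n (perm_of n g)) i) S = zeta (f i) S"
        proof (rule zeta_cong)
          fix A assume "A \<subseteq> S"
          then have "A \<subseteq> {1..n}"
            using S by blast
          then have "act n (perm_of n g) A = g A"
            by (rule act_perm_of[OF triangular_bij[OF tri]])
          then have "shift (act n (perm_of n g)) i A = shift g i A"
            by (simp add: shift_def)
          then show "shift (act n (perm_of n g)) i A = f i A"
            by (simp add: shift[OF i])
        qed
        then show ?thesis
          unfolding f_def by (simp only: zeta_zeta[OF finite_cube[OF S]])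
      qed
      have inC: "i \<in> {1..n} \<and> S \<subseteq> {1..n}" if "(i, S) \<in> C" for i S
      proof -
        have "(i, S) \<in> Sigma {1..n} (adm n c)"
          using C that by blast
        then have "i \<in> {1..n}" "S \<subseteq> {1..<i}"
          using adm_subset[of S n c i] by simp_all
        then show ?thesis
          by fastforce
      qed
      have "(i, S) \<in> \<Phi> (perm_of n g) \<longleftrightarrow> (i, S) \<in> C" for i S
      proof (cases "i \<in> {1..n} \<and> S \<subseteq> {1..n}")
        case True
        then show ?thesis
          using z[of i S] by (simp add: \<Phi>_def)
      next
        case False
        then show ?thesis
          using inC[of i S] by (auto simp: \<Phi>_def)
      qed
      then have "\<Phi> (perm_of n g) = C"
        by (intro Set.set_eqI) (simp only: split_paired_all)
      then show "C \<in> \<Phi> ` perms n (chain n c)"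
        using p by blast
    qed
  qed
  then have "card (perms n (chain n c)) = card (Pow (Sigma {1..n} (adm n c)))"
    by (rule bij_betw_same_card)
  also have "\<dots> = 2 ^ card (Sigma {1..n} (adm n c))"
    by (intro card_Pow finite_SigmaI finite_adm) simp
  finally show ?thesis .
qed

text \<open>
  A monomial \<open>S\<close> is new in the \<open>i\<close>-th shift iff \<open>S\<close> is a partition of \<open>c + i - n\<close> into at least
  two distinct parts. The requirement \<open>S \<subseteq> {1..<i}\<close> is then automatic, since each part is less
  than \<open>c + i - n \<le> i\<close>. As \<open>i\<close> varies, \<open>c + i - n\<close> takes the values up to \<open>c\<close>, whence the sum
  defining \<open>a_seq\<close>.
\<close>

lemma card_new_monomials:
  assumes "c \<le> n" "1 \<le> c"
  shows "card (Sigma {1..n} (adm n c)) = card (Sigma {1..n} (adm n (c - 1))) + a_seq c"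
proof -
  define BS where "BS t = {P :: nat set. finite P \<and> 0 \<notin> P \<and> 2 \<le> card P \<and> \<Sum>P = t}" for t
  define E where "E = {(i, S). i \<in> {1..n} \<and> S \<subseteq> {1..<i} \<and> 2 \<le> card S \<and> \<Sum>S + n = c + i}"
  have finBS: "finite (BS t)" for t
  proof (rule finite_subset)
    show "BS t \<subseteq> Pow {..t}"
      by (auto simp: BS_def intro: member_le_sum[of _ _ "\<lambda>x. x"])
  qed simp
  have arith: "d \<le> 1 \<or> s + n \<le> c + i \<longleftrightarrow>
      (d \<le> 1 \<or> s + n \<le> c - 1 + i) \<or> (2 \<le> d \<and> s + n = c + i)" for d s i :: nat
    using assms(2) by arith
  have adm: "S \<in> adm n c i \<longleftrightarrow>
      S \<in> adm n (c - 1) i \<or> (S \<subseteq> {1..<i} \<and> 2 \<le> card S \<and> \<Sum>S + n = c + i)" for S i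
    unfolding adm_def mem_Collect_eq arith[of "card S" "\<Sum>S" i] by blast
  have split: "Sigma {1..n} (adm n c) = Sigma {1..n} (adm n (c - 1)) \<union> E"
  proof (rule Set.set_eqI)
    fix x :: "nat \<times> nat set"
    obtain i S where "x = (i, S)"
      by (cases x)
    then show "x \<in> Sigma {1..n} (adm n c) \<longleftrightarrow> x \<in> Sigma {1..n} (adm n (c - 1)) \<union> E"
      by (simp only: mem_Sigma_iff Un_iff E_def mem_Collect_eq case_prod_conv adm) blast
  qed
  have disj: "Sigma {1..n} (adm n (c - 1)) \<inter> E = {}"
    using assms(2) by (auto simp: adm_def E_def)
  have "finite (Sigma {1..n} (adm n c))"
    by (intro finite_SigmaI finite_adm) simp
  then have fin: "finite (Sigma {1..n} (adm n (c - 1)))" "finite E"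
    unfolding split by auto
  have "bij_betw (\<lambda>(i, S). (\<Sum>S, S)) E (Sigma {1..c} BS)"
    unfolding bij_betw_def
  proof (intro conjI equalityI)
    show "inj_on (\<lambda>(i, S). (\<Sum>S, S)) E"
      by (rule inj_onI) (auto simp: E_def)
    show "(\<lambda>(i, S). (\<Sum>S, S)) ` E \<subseteq> Sigma {1..c} BS"
    proof
      fix x assume "x \<in> (\<lambda>(i, S). (\<Sum>S, S)) ` E"
      then obtain i S where x: "x = (\<Sum>S, S)" "i \<in> {1..n}" "S \<subseteq> {1..<i}" "2 \<le> card S" "\<Sum>S + n = c + i"
        by (auto simp: E_def)
      have fin: "finite S"
        using x(3) by (rule finite_subset) auto
      have S0: "0 \<notin> S"
        using x(3) by auto
      have "S \<noteq> {}"
        using x(4) by auto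
      then obtain s where "s \<in> S"
        by blast
      then have "1 \<le> \<Sum>S"
        using member_le_sum[of s S "\<lambda>x. x"] fin S0 by (cases s) auto
      then show "x \<in> Sigma {1..c} BS"
        using x fin S0 by (auto simp: BS_def)
    qed
    show "Sigma {1..c} BS \<subseteq> (\<lambda>(i, S). (\<Sum>S, S)) ` E"
    proof
      fix x assume "x \<in> Sigma {1..c} BS"
      then obtain S where x: "x = (\<Sum>S, S)" "1 \<le> \<Sum>S" "\<Sum>S \<le> c" "finite S" "0 \<notin> S" "2 \<le> card S"
        by (auto simp: BS_def)
      define i where "i = \<Sum>S + n - c"
      have "s \<in> {1..<i}" if s: "s \<in> S" for s
      proof -
        \<comment> \<open>A second part of size at least 1 makes each part less than the sum.\<close>
        have "S - {s} \<noteq> {}"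
          using x(6) s by (metis card_Diff_singleton card.empty diff_is_0_eq not_less_eq_eq numeral_2_eq_2 one_le_numeral One_nat_def)
        then obtain u where u: "u \<in> S" "u \<noteq> s"
          by blast
        have "\<Sum>{s, u} \<le> \<Sum>S"
          using s u x(4) by (intro sum_mono2) auto
        then have "s + u \<le> \<Sum>S"
          using u by simp
        moreover have "1 \<le> s" "1 \<le> u"
          using s u x(5) by (metis less_one linorder_not_less)+
        ultimately show ?thesis
          using assms(1) by (simp add: i_def)
      qed
      then have "(i, S) \<in> E"
        using x assms by (auto simp: E_def i_def)
      then show "x \<in> (\<lambda>(i, S). (\<Sum>S, S)) ` E"
        using x(1) by force
    qed
  qed
  then have "card E = card (Sigma {1..c} BS)"
    by (rule bij_betw_same_card)
  also have "\<dots> = a_seq c"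
    using finBS by (simp add: card_SigmaI a_seq_def b_seq_def BS_def)
  finally show ?thesis
    unfolding split using card_Un_disjoint[OF fin disj] by simp
qed

lemma subgroup_index_eq:
  assumes "group G" "subgroup K G" "subgroup H G" "H \<subseteq> K"
  shows "subgroup_index G K H * card H = card K"
proof -
  have "group (G\<lparr>carrier := K\<rparr>)"
    by (rule group.subgroup_imp_group[OF assms(1,2)])
  moreover have "subgroup H (G\<lparr>carrier := K\<rparr>)"
    by (rule group.subgroup_incl[OF assms(1,3,2,4)])
  ultimately show ?thesis
    unfolding subgroup_index_def using group.lagrange by (fastforce simp: order_def)
qed

theorem norm_chain_index:
  assumes "1 \<le> k" "k + 2 \<le> n"
  shows "subgroup_index (sym_group (2 ^ n)) (norm_chain n k) (norm_chain n (k - 1)) = 2 ^ a_seq (k + 2)"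
proof -
  have K: "norm_chain n k = perms n (chain n (k + 2))"
    "norm_chain n (k - 1) = perms n (chain n (k + 1))"
    using norm_chain_eq[of k n] norm_chain_eq[of "k - 1" n] assms by auto
  have "chain n (k + 1) \<subseteq> chain n (k + 2)"
  proof
    fix g assume g: "g \<in> chain n (k + 1)"
    show "g \<in> chain n (k + 2)"
      by (rule chainI[OF chain_maps[OF g] polys_mono[OF chain_shift[OF g]]])
         (use adm_mono[of "k + 1" "k + 2" n] in auto)
  qed
  then have "subgroup_index (sym_group (2 ^ n)) (norm_chain n k) (norm_chain n (k - 1))
      * card (norm_chain n (k - 1)) = card (norm_chain n k)"
    unfolding K using assms
    by (intro subgroup_index_eq sym_group_is_group perms_chain_subgroup perms_mono) auto
  moreover have "card (Sigma {1..n} (adm n (k + 2))) = card (Sigma {1..n} (adm n (k + 1))) + a_seq (k + 2)"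
    using card_new_monomials[of "k + 2" n] assms by simp
  ultimately show ?thesis
    unfolding K card_perms_chain by (simp add: power_add)
qed

theorem theorem4p7:
  fixes k :: nat
  assumes "1 \<le> k" and "k \<le> 4"
  shows "(\<forall>n \<ge> k + 2.
            log 2 (real (subgroup_index (sym_group (2 ^ n)) (norm_chain n k) (norm_chain n (k - 1))))
              = real (a_seq (k + 2)))
       \<and> (\<forall>m \<ge> k + 2. \<forall>n \<ge> k + 2.
            log 2 (real (subgroup_index (sym_group (2 ^ m)) (norm_chain m k) (norm_chain m (k - 1))))
              = log 2 (real (subgroup_index (sym_group (2 ^ n)) (norm_chain n k) (norm_chain n (k - 1)))))"
proof -
  have *: "log 2 (real (subgroup_index (sym_group (2 ^ n)) (norm_chain n k) (norm_chain n (k - 1))))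
      = real (a_seq (k + 2))" if "k + 2 \<le> n" for n
    unfolding norm_chain_index[OF assms(1) that] by (simp add: log_nat_power)
  show ?thesis
    by (intro conjI allI impI) (simp_all only: *)
qed

end
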